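(* Let $x$ be the mean square asymptotically stable solution of the uncontrolled equation $$dx(t)=Ax(t)\,dt+\sum_{i=1}^qN_ix(t)\,dw_i(t),\quad x(0)=x_0=X_0v,$$ with $v\in\mathbb R^d$. Let $\mathbf P\ge0$ be a symmetric matrix satisfying $$A\mathbf P+\mathbf PA^\top+\sum_{i,j=1}^qN_i\mathbf PN_j^\top k_{ij}+X_0X_0^\top=0,$$ and let $(\mathbf p_k)_{k=1,\dots,n}$ be an orthonormal basis of $\mathbb R^n$ of eigenvectors of $\mathbf P$ with associated eigenvalues $\boldsymbol\lambda_k\ge0$. Then, for each $k$, $$\int_0^\infty\mathbb E\,|\langle x(t),\mathbf p_k\rangle_2|^2\,dt\le\boldsymbol\lambda_k\,\|v\|_2^2 .$$
   Context: Setting: $(\Omega,\mathcal F,(\mathcal F_t),\mathbb P)$ is a filtered probability space with right-continuous and complete filtration; $w=(w_1,\dots,w_q)^\top$ is an $\mathbb R^q$-valued $(\mathcal F_t)$-adapted Wiener process (here on $[0,\infty)$) whose increments $w(t+h)-w(t)$ are independent of $\mathcal F_t$, with covariance matrix $K=(k_{ij})_{i,j=1,\dots,q}$, i.e. $\mathbb E[w(t)w(t)^\top]=Kt$. The coefficients are $A,N_i\in\mathbb R^{n\times n}$, $X_0\in\mathbb R^{n\times d}$. $\langle\cdot,\cdot\rangle_2$, $\|\cdot\|_2$ are the Euclidean inner product and norm. Mean square asymptotic stability means: for any initial state $x_0\in\mathbb R^n$, $\mathbb E\|x(t)\|_2^2\to0$ as $t\to\infty$. *)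

theory Defs
  imports "HOL-Probability.Probability"
begin

section \<open>Filtered probability spaces and Wiener processes\<close>

text \<open>Processes and filtrations are indexed by \<open>real\<close>; only the times \<open>t \<ge> 0\<close> are constrained.\<close>

locale filtered_prob_space = prob_space M
  for M :: "'a measure" +
  fixes F :: "real \<Rightarrow> 'a measure"
  assumes filtration_subalgebra: "0 \<le> t \<Longrightarrow> subalgebra M (F t)"
    and filtration_mono: "0 \<le> s \<Longrightarrow> s \<le> t \<Longrightarrow> sets (F s) \<subseteq> sets (F t)"
    and filtration_right_continuous: "0 \<le> t \<Longrightarrow> sets (F t) = (\<Inter>s\<in>{t<..}. sets (F s))"
    and filtration_complete: "B \<in> null_sets M \<Longrightarrow> C \<subseteq> B \<Longrightarrow> C \<in> sets (F 0)"

text \<open>The normal law with mean \<open>m\<close> and variance \<open>v \<ge> 0\<close>. The degenerate case is treated separately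
  because covariance matrices of Wiener processes may be singular.\<close>

definition normal_law :: "real \<Rightarrow> real \<Rightarrow> real measure" where
  "normal_law m v =
     (if v = 0 then return borel m else density lborel (\<lambda>y. ennreal (normal_density m (sqrt v) y)))"

text \<open>An \<open>\<real>\<^sup>q\<close>-valued Wiener process with covariance matrix \<open>K\<close>. That the increments
  are centred Gaussian vectors is expressed through the one-dimensional laws of their linear
  functionals. These laws see only the symmetric part of \<open>K\<close>; the last assumption determines
  \<open>K\<close> completely (and makes it symmetric and positive semidefinite).\<close>

locale wiener_process = filtered_prob_space M F
  for M :: "'a measure" and F :: "real \<Rightarrow> 'a measure" +
  fixes K :: "real ^ 'q ^ 'q" and w :: "real \<Rightarrow> 'a \<Rightarrow> real ^ 'q"
  assumes wiener_adapted: "0 \<le> t \<Longrightarrow> w t \<in> borel_measurable (F t)"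
    and wiener_start: "AE \<omega> in M. w 0 \<omega> = 0"
    and wiener_continuous: "AE \<omega> in M. continuous_on {0..} (\<lambda>t. w t \<omega>)"
    and wiener_indep_increments: "0 \<le> t \<Longrightarrow> 0 \<le> h \<Longrightarrow>
      indep_set (sets (F t)) (sets (vimage_algebra (space M) (\<lambda>\<omega>. w (t + h) \<omega> - w t \<omega>) borel))"
    and wiener_gaussian_increments: "0 \<le> t \<Longrightarrow> 0 \<le> h \<Longrightarrow>
      distr M borel (\<lambda>\<omega>. u \<bullet> (w (t + h) \<omega> - w t \<omega>)) = normal_law 0 (h * (u \<bullet> (K *v u)))"
    and wiener_covariance: "0 \<le> t \<Longrightarrow> expectation (\<lambda>\<omega>. w t \<omega> $ i * w t \<omega> $ j) = K $ i $ j * t"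


section \<open>The Ito integral\<close>

text \<open>A simple integrand \<open>\<Sum>k<m. \<phi> k * 1_(\<tau> k, \<tau> (k + 1)]\<close> on \<open>[0, T]\<close> is given by its
  partition points \<open>\<tau> 0 < \<dots> < \<tau> m\<close> and its bounded coefficients, \<open>\<phi> k\<close> being measurable
  with respect to \<open>F (\<tau> k)\<close>.\<close>

definition simple_integrand ::
  "'a measure \<Rightarrow> (real \<Rightarrow> 'a measure) \<Rightarrow> real \<Rightarrow> nat \<Rightarrow> (nat \<Rightarrow> real) \<Rightarrow>
   (nat \<Rightarrow> 'a \<Rightarrow> 'b::euclidean_space) \<Rightarrow> bool" where
  "simple_integrand M F T m \<tau> \<phi> \<longleftrightarrow>
     0 \<le> \<tau> 0 \<and> (\<forall>k<m. \<tau> k < \<tau> (Suc k)) \<and> \<tau> m \<le> T \<and>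
     (\<forall>k<m. \<phi> k \<in> borel_measurable (F (\<tau> k)) \<and> bounded (\<phi> k ` space M))"

definition simple_process ::
  "nat \<Rightarrow> (nat \<Rightarrow> real) \<Rightarrow> (nat \<Rightarrow> 'a \<Rightarrow> 'b::euclidean_space) \<Rightarrow> real \<Rightarrow> 'a \<Rightarrow> 'b" where
  "simple_process m \<tau> \<phi> s \<omega> = (\<Sum>k<m. indicator {\<tau> k<..\<tau> (Suc k)} s *\<^sub>R \<phi> k \<omega>)"

definition simple_ito_integral ::
  "(real \<Rightarrow> 'a \<Rightarrow> real) \<Rightarrow> nat \<Rightarrow> (nat \<Rightarrow> real) \<Rightarrow> (nat \<Rightarrow> 'a \<Rightarrow> 'b::euclidean_space) \<Rightarrow> 'a \<Rightarrow> 'b" where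
  "simple_ito_integral B m \<tau> \<phi> \<omega> = (\<Sum>k<m. (B (\<tau> (Suc k)) \<omega> - B (\<tau> k) \<omega>) *\<^sub>R \<phi> k \<omega>)"

text \<open>Admissible integrands on \<open>[0, T]\<close>: progressively measurable and square integrable with respect
  to \<open>P \<otimes> dt\<close>.\<close>

definition ito_integrand ::
  "'a measure \<Rightarrow> (real \<Rightarrow> 'a measure) \<Rightarrow> real \<Rightarrow> (real \<Rightarrow> 'a \<Rightarrow> 'b::euclidean_space) \<Rightarrow> bool" where
  "ito_integrand M F T f \<longleftrightarrow>
     (\<forall>t\<in>{0..T}. (\<lambda>(s, \<omega>). f s \<omega>) \<in> borel_measurable (restrict_space borel {0..t} \<Otimes>\<^sub>M F t)) \<and>
     (\<integral>\<^sup>+\<omega>. (\<integral>\<^sup>+s\<in>{0..T}. ennreal ((norm (f s \<omega>))\<^sup>2) \<partial>lborel) \<partial>M) < \<infinity>"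

text \<open>\<open>J\<close> is (a version of) the Ito integral of \<open>f\<close> over \<open>[0, T]\<close> with respect to the
  scalar Wiener process \<open>B\<close>, i.e. the mean square limit of the integrals of simple
  integrands that approximate \<open>f\<close> in \<open>L\<^sup>2(P \<otimes> dt)\<close>. By the Ito isometry the limit does not
  depend on the approximating sequence, up to null sets.\<close>

definition has_ito_integral ::
  "'a measure \<Rightarrow> (real \<Rightarrow> 'a measure) \<Rightarrow> (real \<Rightarrow> 'a \<Rightarrow> real) \<Rightarrow> real \<Rightarrow>
   (real \<Rightarrow> 'a \<Rightarrow> 'b::euclidean_space) \<Rightarrow> ('a \<Rightarrow> 'b) \<Rightarrow> bool" where
  "has_ito_integral M F B T f J \<longleftrightarrow>
     ito_integrand M F T f \<and> J \<in> borel_measurable M \<and>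
     (\<exists>m \<tau> \<phi>.
        (\<forall>n. simple_integrand M F T (m n) (\<tau> n) (\<phi> n)) \<and>
        (\<lambda>n. \<integral>\<^sup>+\<omega>. (\<integral>\<^sup>+s\<in>{0..T}.
              ennreal ((norm (f s \<omega> - simple_process (m n) (\<tau> n) (\<phi> n) s \<omega>))\<^sup>2) \<partial>lborel) \<partial>M)
          \<longlonglongrightarrow> 0 \<and>
        (\<lambda>n. \<integral>\<^sup>+\<omega>. ennreal ((norm (J \<omega> - simple_ito_integral B (m n) (\<tau> n) (\<phi> n) \<omega>))\<^sup>2) \<partial>M)
          \<longlonglongrightarrow> 0)"


section \<open>Linear stochastic differential equations\<close>

text \<open>Solutions of \<open>dx = A x dt + \<Sum>i. N i x dw_i\<close>, \<open>x(0) = x0\<close>, on \<open>[0, \<infinity>)\<close>, in the integrated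
  sense. As usual in the \<open>L\<^sup>2\<close> theory, the solution itself lies in the space of admissible
  integrands on every bounded interval.\<close>

definition linear_sde_solution ::
  "'a measure \<Rightarrow> (real \<Rightarrow> 'a measure) \<Rightarrow> (real \<Rightarrow> 'a \<Rightarrow> real ^ 'q) \<Rightarrow>
   real ^ 'n ^ 'n \<Rightarrow> ('q \<Rightarrow> real ^ 'n ^ 'n) \<Rightarrow> real ^ 'n \<Rightarrow> (real \<Rightarrow> 'a \<Rightarrow> real ^ 'n) \<Rightarrow> bool" where
  "linear_sde_solution M F w A N x0 x \<longleftrightarrow>
     (\<forall>T\<ge>0. ito_integrand M F T x) \<and>
     (AE \<omega> in M. continuous_on {0..} (\<lambda>t. x t \<omega>)) \<and>
     (AE \<omega> in M. x 0 \<omega> = x0) \<and>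
     (\<forall>t\<ge>0. \<exists>J.
        (\<forall>i. has_ito_integral M F (\<lambda>s \<omega>. w s \<omega> $ i) t (\<lambda>s \<omega>. N i *v x s \<omega>) (J i)) \<and>
        (AE \<omega> in M. x t \<omega> = x0 + (LINT s:{0..t}|lborel. A *v x s \<omega>) + (\<Sum>i\<in>UNIV. J i \<omega>)))"

definition mean_square_asymptotically_stable ::
  "'a measure \<Rightarrow> (real \<Rightarrow> 'a measure) \<Rightarrow> (real \<Rightarrow> 'a \<Rightarrow> real ^ 'q) \<Rightarrow>
   real ^ 'n ^ 'n \<Rightarrow> ('q \<Rightarrow> real ^ 'n ^ 'n) \<Rightarrow> bool" where
  "mean_square_asymptotically_stable M F w A N \<longleftrightarrow>
     (\<forall>x0 x. linear_sde_solution M F w A N x0 x \<longrightarrow>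
        ((\<lambda>t. \<integral>\<^sup>+\<omega>. ennreal ((norm (x t \<omega>))\<^sup>2) \<partial>M) \<longlongrightarrow> 0) at_top)"


section \<open>Linear algebra\<close>

definition positive_semidefinite :: "real ^ 'n ^ 'n \<Rightarrow> bool" where
  "positive_semidefinite P \<longleftrightarrow> transpose P = P \<and> (\<forall>u. 0 \<le> u \<bullet> (P *v u))"

definition orthonormal_basis :: "('n \<Rightarrow> real ^ 'n) \<Rightarrow> bool" where
  "orthonormal_basis p \<longleftrightarrow>
     (\<forall>k l. p k \<bullet> p l = (if k = l then 1 else 0)) \<and> span (range p) = UNIV"

end

theory Submission imports Defs begin

text \<open>Let \<open>Y t = E[x(t) x(t)\<^sup>T]\<close>, let \<open>L S = A S + S A\<^sup>T + \<Phi> S\<close> with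
  \<open>\<Phi> S = \<Sum>i j. k\<^sub>i\<^sub>j N\<^sub>i S N\<^sub>j\<^sup>T\<close>, and let \<open>Z t = \<integral>\<^sub>0\<^sup>t Y\<close>. The integral to be bounded is the
  limit of the quadratic form of \<open>Z T\<close> at \<open>p\<^sub>k\<close> as \<open>T \<rightarrow> \<infinity>\<close>, and \<open>p\<^sub>k \<bullet> P p\<^sub>k = \<lambda>\<^sub>k\<close>. So it suffices that
  \<open>R t = \<parallel>v\<parallel>\<^sup>2 P - Z t\<close> is positive semidefinite for every \<open>t \<ge> 0\<close>.

  The second moments solve the linear equation \<open>Y t = x\<^sub>0 x\<^sub>0\<^sup>T + L (Z t)\<close>
  (\<open>second_moment_integral_equation\<close>). Together with \<open>L P = - X\<^sub>0 X\<^sub>0\<^sup>T\<close> this gives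
  \<open>R' = L R + D\<close> with \<open>D = \<parallel>v\<parallel>\<^sup>2 X\<^sub>0 X\<^sub>0\<^sup>T - x\<^sub>0 x\<^sub>0\<^sup>T\<close>, which is positive semidefinite by the
  Cauchy-Schwarz inequality, and \<open>R 0 = \<parallel>v\<parallel>\<^sup>2 P\<close> is positive semidefinite as well. Since \<open>\<Phi>\<close>
  maps positive semidefinite matrices to matrices with nonnegative quadratic form
  (\<open>covariance_weighted_form_nonneg\<close>), the flow of \<open>L\<close> cannot leave the positive semidefinite
  cone (\<open>quasi_monotone_flow_nonneg\<close>), and \<open>R t\<close> stays in it.

  The equation for \<open>Y\<close> is obtained from the isometry of the Ito integral, without the Ito
  formula. For a fixed vector \<open>u\<close>, the scalar process \<open>\<xi> = u \<bullet> x\<close> is the sum of a constant, of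
  the absolutely continuous process \<open>\<integral> \<alpha>\<close> with \<open>\<alpha> = u \<bullet> A x\<close>, and of a martingale \<open>m\<close>. In the
  expansion of \<open>\<xi>\<^sup>2\<close> the square of \<open>m\<close> is given by the isometry (\<open>ito_isometry\<close>), the mixed
  term by \<open>E[\<alpha>(s) m(t)] = E[\<alpha>(s) m(s)]\<close> for \<open>s \<le> t\<close> (\<open>expectation_past_mult_ito_limit\<close>), and
  the square of the absolutely continuous part by the fundamental theorem of calculus; this is
  \<open>second_moment_drift_plus_martingale\<close>.\<close>

section \<open>Quadratic forms of symmetric matrices\<close>

text \<open>The quadratic form is minimal at \<open>u\<close>, so its derivative in the direction \<open>S u\<close>, which is
  \<open>2 \<parallel>S u\<parallel>\<^sup>2\<close>, vanishes.\<close>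

lemma positive_semidefinite_kernel:
  fixes S :: "real ^ 'n ^ 'n"
  assumes "positive_semidefinite S" and "u \<bullet> (S *v u) = 0"
  shows "S *v u = 0"
proof -
  let ?y = "S *v u"
  have sym: "u \<bullet> (S *v ?y) = ?y \<bullet> ?y"
    using assms(1) by (metis dot_lmul_matrix positive_semidefinite_def transpose_matrix_vector inner_commute)
  have quad: "0 \<le> 2 * h * (?y \<bullet> ?y) + h\<^sup>2 * (?y \<bullet> (S *v ?y))" for h :: real
  proof -
    have "0 \<le> (u + h *\<^sub>R ?y) \<bullet> (S *v (u + h *\<^sub>R ?y))"
      using assms(1) by (simp add: positive_semidefinite_def)
    also have "\<dots> = 2 * h * (?y \<bullet> ?y) + h\<^sup>2 * (?y \<bullet> (S *v ?y))"
      using sym assms(2)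
      by (simp add: matrix_vector_right_distrib matrix_vector_mult_scaleR inner_add_left
          inner_add_right power2_eq_square algebra_simps)
    finally show ?thesis .
  qed
  define a where "a = ?y \<bullet> ?y"
  define b where "b = ?y \<bullet> (S *v ?y)"
  have b: "0 \<le> b" using assms(1) by (simp add: b_def positive_semidefinite_def)
  have a: "0 \<le> a" by (simp add: a_def)
  have "a = 0"
  proof (rule ccontr)
    assume "a \<noteq> 0"
    hence a: "a > 0" using a by simp
    \<comment> \<open>a negative step so small that the linear term \<open>2 h a\<close> outweighs \<open>h\<^sup>2 b\<close>; the \<open>1\<close> covers \<open>b = 0\<close>\<close>
    define h where "h = - a / (b + 1)"
    have "h * (b + 1) = - a" using b by (simp add: h_def)
    have "h < 0" using a b by (simp add: h_def)
    have "0 \<le> h * (2 * a + h * b)" using quad[of h]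
      by (simp add: a_def b_def power2_eq_square algebra_simps)
    hence "2 * a + h * b \<le> 0" using \<open>h < 0\<close> by (simp add: zero_le_mult_iff)
    moreover have "h * b = - a - h" using \<open>h * (b + 1) = - a\<close> by (simp add: algebra_simps)
    ultimately show False using a \<open>h < 0\<close> by simp
  qed
  thus ?thesis by (simp add: a_def)
qed

lemma matrix_eq_0_if_quadratic_form_eq_0:
  fixes S :: "real ^ 'n ^ 'n"
  assumes "transpose S = S" and "\<And>u. u \<bullet> (S *v u) = 0"
  shows "S = 0"
proof -
  have "positive_semidefinite S" using assms by (simp add: positive_semidefinite_def)
  hence "S *v u = 0" for u using assms(2) by (rule positive_semidefinite_kernel)
  thus ?thesis by (simp add: matrix_eq)
qed

lemma bounded_linear_quadratic_form:
  "bounded_linear (\<lambda>S :: real ^ 'n ^ 'n. u \<bullet> (S *v u))"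
  unfolding linear_conv_bounded_linear[symmetric]
  by (rule linearI) (simp_all add: matrix_vector_mult_add_rdistrib inner_add_right scaleR_matrix_vector_assoc[symmetric])

lemma linear_matrix_sandwich: "linear (\<lambda>S :: real ^ 'n ^ 'n. B ** S ** (C :: real ^ 'n ^ 'n))"
  by (rule linearI)
     (simp_all add: matrix_eq matrix_vector_mul_assoc[symmetric] matrix_vector_mult_add_rdistrib
       matrix_vector_right_distrib scaleR_matrix_vector_assoc[symmetric] matrix_vector_mult_scaleR)

section \<open>Positivity of quasi-monotone linear flows\<close>

text \<open>Let \<open>L S = A S + S A\<^sup>T + \<Phi> S\<close>. If the quadratic form of \<open>R\<close> touches zero at a vector \<open>u\<close>
  for the first time, then \<open>R u = 0\<close>, so that the terms \<open>A R + R A\<^sup>T\<close> contribute nothing to the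
  derivative of the form at \<open>u\<close>, and the remaining terms \<open>\<Phi> R + D\<close> push it upwards. To make this
  rigorous, \<open>R\<close> is perturbed by \<open>e exp(c t) I\<close>, where \<open>c\<close> exceeds the quadratic form of \<open>L I\<close> on
  the unit sphere: the form of the perturbed \<open>R\<close> then is strictly positive at time \<open>0\<close> and would
  have a strictly positive derivative at its first zero, which is impossible.\<close>

lemma quasi_monotone_flow_nonneg:
  fixes A D :: "real ^ 'n ^ 'n" and \<Phi> :: "real ^ 'n ^ 'n \<Rightarrow> real ^ 'n ^ 'n"
    and R :: "real \<Rightarrow> real ^ 'n ^ 'n"
  assumes lin: "linear \<Phi>"
    and pos: "\<And>S u. positive_semidefinite S \<Longrightarrow> 0 \<le> u \<bullet> (\<Phi> S *v u)"
    and deriv: "\<And>t. t \<in> {0..T} \<Longrightarrow>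
      (R has_vector_derivative (A ** R t + R t ** transpose A + \<Phi> (R t) + D)) (at t within {0..T})"
    and sym: "\<And>t. t \<in> {0..T} \<Longrightarrow> transpose (R t) = R t"
    and R0: "\<And>u. 0 \<le> u \<bullet> (R 0 *v u)"
    and D: "\<And>u. 0 \<le> u \<bullet> (D *v u)"
    and t: "t \<in> {0..T}"
  shows "0 \<le> u \<bullet> (R t *v u)"
proof -
  define L where "L S = A ** S + S ** transpose A + \<Phi> S" for S
  have linL: "linear L"
    unfolding L_def
    using linear_matrix_sandwich[of A "mat 1"] linear_matrix_sandwich[of "mat 1" "transpose A"]
    by (intro linear_compose_add lin) simp_all
  obtain C where C: "u \<bullet> (L (mat 1) *v u) \<le> C" if "norm u = 1" for u
  proof
    fix u :: "real ^ 'n" assume "norm u = 1"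
    have "u \<bullet> (L (mat 1) *v u) \<le> norm u * norm (L (mat 1) *v u)" by (rule norm_cauchy_schwarz)
    also have "\<dots> \<le> onorm ((*v) (L (mat 1)))"
      using onorm[OF matrix_vector_mul_bounded_linear, of "L (mat 1)" u] \<open>norm u = 1\<close> by simp
    finally show "u \<bullet> (L (mat 1) *v u) \<le> onorm ((*v) (L (mat 1)))" .
  qed
  define c where "c = C + 1"
  have pert: "0 < u \<bullet> ((R t + (e * exp (c * t)) *\<^sub>R mat 1) *v u)"
    if e: "e > 0" and u: "norm u = 1" and t: "t \<in> {0..T}" for e t :: real and u :: "real ^ 'n"
  proof (rule ccontr)
    define S where "S t = R t + (e * exp (c * t)) *\<^sub>R mat 1" for t
    define q where "q z = snd z \<bullet> (S (fst z) *v snd z)" for z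
    have dS: "(S has_vector_derivative (L (R t) + D + (e * (c * exp (c * t))) *\<^sub>R mat 1))
        (at t within {0..T})" if "t \<in> {0..T}" for t
      unfolding S_def L_def
      by (rule derivative_eq_intros deriv[OF that] refl | simp)+
    have contS: "continuous_on {0..T} S"
      using dS has_vector_derivative_continuous continuous_on_eq_continuous_within by blast
    have cont: "continuous_on ({0..T} \<times> sphere 0 1) q"
    proof -
      have "continuous_on ({0..T} \<times> (sphere 0 1 :: (real ^ 'n) set)) (\<lambda>z. S (fst z))"
        by (rule continuous_on_compose2[OF contS continuous_on_fst[OF continuous_on_id]]) auto
      hence "continuous_on ({0..T} \<times> (sphere 0 1 :: (real ^ 'n) set)) (\<lambda>z. S (fst z) *v snd z)"
        unfolding matrix_vector_mult_def
        by (intro continuous_intros)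
      thus ?thesis unfolding q_def by (intro continuous_intros)
    qed
    have comp: "compact ({0..T} \<times> (sphere 0 1 :: (real ^ 'n) set))"
      by (intro compact_Times compact_Icc compact_sphere)
    \<comment> \<open>the compact set of zeros and negative values; its point of least time is the first zero\<close>
    define B where "B = {z \<in> {0..T} \<times> sphere 0 1. q z \<le> 0}"
    assume "\<not> ?thesis"
    hence "(t, u) \<in> B" using u t by (simp add: B_def q_def S_def)
    hence "B \<noteq> {}" by auto
    moreover have "compact B"
    proof -
      have "closed B"
        unfolding B_def using cont compact_imp_closed[OF comp]
        by (intro continuous_on_closed_Collect_le[of _ q "\<lambda>_. 0"]) auto
      moreover have "B = ({0..T} \<times> sphere 0 1) \<inter> B" by (auto simp: B_def)
      ultimately show ?thesis using comp by (metis compact_Int_closed)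
    qed
    ultimately have "\<exists>z\<in>B. \<forall>y\<in>B. fst z \<le> fst y"
      by (intro continuous_attains_inf continuous_on_fst continuous_on_id)
    then obtain z where z: "z \<in> B" and zmin: "\<And>y. y \<in> B \<Longrightarrow> fst z \<le> fst y"
      by blast
    obtain t0 u0 where z_eq: "z = (t0, u0)" by (cases z)
    have t0: "t0 \<in> {0..T}" and u0: "norm u0 = 1" and q0: "q (t0, u0) \<le> 0"
      using z by (auto simp: B_def z_eq)
    have before: "0 < q (s, y)" if "s \<in> {0..<t0}" "norm y = 1" for s y
      using zmin[of "(s, y)"] that t0 by (force simp: B_def z_eq not_le)
    have "t0 \<noteq> 0"
    proof
      assume "t0 = 0"
      have "q (0, u0) = u0 \<bullet> (R 0 *v u0) + e"
        using u0 by (simp add: q_def S_def matrix_vector_mult_add_rdistrib inner_add_right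
            scaleR_matrix_vector_assoc[symmetric] norm_eq_1)
      thus False using q0 \<open>t0 = 0\<close> R0[of u0] e by simp
    qed
    hence t0pos: "t0 > 0" using t0 by simp
    have contq: "continuous_on {0..T} (\<lambda>s. q (s, y))" for y
      unfolding q_def fst_conv snd_conv
      by (rule bounded_linear.continuous_on[OF bounded_linear_quadratic_form contS])
    \<comment> \<open>up to time \<open>t0\<close> the form was positive, so at time \<open>t0\<close> it is still nonnegative\<close>
    have nonneg1: "0 \<le> q (t0, y)" if "norm y = 1" for y
    proof -
      have "closed {s \<in> {0..t0}. 0 \<le> q (s, y)}"
        using continuous_on_subset[OF contq[of y]] t0
        by (intro continuous_on_closed_Collect_le[of _ "\<lambda>_. 0" "\<lambda>s. q (s, y)"]) auto
      moreover have "{0..<t0} \<subseteq> {s \<in> {0..t0}. 0 \<le> q (s, y)}"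
        using before[OF _ that] by (auto intro: less_imp_le)
      ultimately have "closure {0..<t0} \<subseteq> {s \<in> {0..t0}. 0 \<le> q (s, y)}" by (rule closure_minimal[rotated])
      moreover have "t0 \<in> closure {0..<t0}" using t0pos by simp
      ultimately show ?thesis by blast
    qed
    have nonneg: "0 \<le> y \<bullet> (S t0 *v y)" for y
    proof (cases "y = 0")
      case False
      have "0 \<le> q (t0, y /\<^sub>R norm y)" using nonneg1 False by simp
      also have "q (t0, y /\<^sub>R norm y) = (y \<bullet> (S t0 *v y)) / (norm y)\<^sup>2"
        by (simp add: q_def matrix_vector_mult_scaleR power2_eq_square divide_inverse)
      finally show ?thesis using False by (simp add: zero_le_divide_iff)
    qed simp
    have psd: "positive_semidefinite (S t0)"
      unfolding positive_semidefinite_def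
    proof (intro conjI allI)
      show "transpose (S t0) = S t0"
        using sym[OF t0]
        by (simp add: S_def vec_eq_iff transpose_def mat_def)
    qed (rule nonneg)
    have q00: "u0 \<bullet> (S t0 *v u0) = 0"
      using q0 nonneg[of u0] by (simp add: q_def)
    have ker: "S t0 *v u0 = 0" by (rule positive_semidefinite_kernel[OF psd q00])
    have "u0 \<bullet> (L (S t0) *v u0) = u0 \<bullet> (\<Phi> (S t0) *v u0)"
    proof -
      have 1: "(A ** S t0) *v u0 = 0" using ker by (simp add: matrix_vector_mul_assoc[symmetric])
      have "u0 \<bullet> ((S t0 ** transpose A) *v u0) = (u0 v* S t0) \<bullet> (transpose A *v u0)"
        by (simp add: matrix_vector_mul_assoc[symmetric] dot_lmul_matrix)
      also have "u0 v* S t0 = S t0 *v u0"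
        using psd by (metis positive_semidefinite_def transpose_matrix_vector)
      finally have 2: "u0 \<bullet> ((S t0 ** transpose A) *v u0) = 0" using ker by simp
      show ?thesis using 1 2 by (simp add: L_def matrix_vector_mult_add_rdistrib inner_add_right)
    qed
    hence Lpos: "0 \<le> u0 \<bullet> (L (S t0) *v u0)" using pos[OF psd] by simp
    define l where "l = u0 \<bullet> ((L (R t0) + D + (e * (c * exp (c * t0))) *\<^sub>R mat 1) *v u0)"
    have LS: "L (S t0) = L (R t0) + (e * exp (c * t0)) *\<^sub>R L (mat 1)"
      by (simp add: S_def linear_add[OF linL] linear_scale[OF linL])
    have "l = u0 \<bullet> (L (S t0) *v u0) + u0 \<bullet> (D *v u0) + e * exp (c * t0) * (c - u0 \<bullet> (L (mat 1) *v u0))"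
      using u0 unfolding LS l_def
      by (simp add: matrix_vector_mult_add_rdistrib inner_add_right
            scaleR_matrix_vector_assoc[symmetric] norm_eq_1 algebra_simps)
    moreover have "0 < e * exp (c * t0) * (c - u0 \<bullet> (L (mat 1) *v u0))"
      using C[OF u0] e by (simp add: c_def)
    ultimately have lpos: "0 < l" using Lpos D[of u0] by simp
    have "((\<lambda>s. q (s, u0)) has_real_derivative l) (at t0 within {0..T})"
      unfolding q_def fst_conv snd_conv l_def has_real_derivative_iff_has_vector_derivative
      by (rule bounded_linear.has_vector_derivative[OF bounded_linear_quadratic_form dS[OF t0]])
    from has_real_derivative_pos_inc_left[OF this lpos]
    obtain d where d: "d > 0" "\<And>h. 0 < h \<Longrightarrow> t0 - h \<in> {0..T} \<Longrightarrow> h < d \<Longrightarrow> q (t0 - h, u0) < q (t0, u0)"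
      by blast
    define h where "h = min (d / 2) t0"
    have "0 < h" "h < d" "t0 - h \<in> {0..T}" "t0 - h \<in> {0..<t0}" using d t0 t0pos by (auto simp: h_def)
    from d(2)[OF this(1,3,2)] before[OF this(4) u0] q0 show False by simp
  qed
  show ?thesis
  proof (cases "u = 0")
    case False
    define y where "y = u /\<^sub>R norm u"
    have ny: "norm y = 1" using False by (simp add: y_def)
    have uy: "u = norm u *\<^sub>R y" using False by (simp add: y_def)
    have "0 \<le> y \<bullet> (R t *v y)"
    proof (rule field_le_epsilon)
      fix e :: real assume "e > 0"
      hence "0 < y \<bullet> ((R t + ((e / exp (c * t)) * exp (c * t)) *\<^sub>R mat 1) *v y)"
        by (intro pert ny t) simp
      also have "\<dots> = y \<bullet> (R t *v y) + e"
        using ny by (simp add: matrix_vector_mult_add_rdistrib inner_add_right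
            scaleR_matrix_vector_assoc[symmetric] norm_eq_1)
      finally show "0 \<le> y \<bullet> (R t *v y) + e" by simp
    qed
    hence "0 \<le> (norm u)\<^sup>2 * (y \<bullet> (R t *v y))" by simp
    also have "\<dots> = (norm u *\<^sub>R y) \<bullet> (R t *v (norm u *\<^sub>R y))"
      by (simp add: matrix_vector_mult_scaleR power2_eq_square)
    also have "\<dots> = u \<bullet> (R t *v u)" by (simp only: uy[symmetric])
    finally show ?thesis .
  qed simp
qed

section \<open>Mean square convergence\<close>

definition square_integrable :: "'a measure \<Rightarrow> ('a \<Rightarrow> real) \<Rightarrow> bool" where
  "square_integrable N f \<longleftrightarrow> f \<in> borel_measurable N \<and> integrable N (\<lambda>x. (f x)\<^sup>2)"

lemma square_integrableD:
  assumes "square_integrable N f"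
  shows "f \<in> borel_measurable N" "integrable N (\<lambda>x. (f x)\<^sup>2)"
  using assms by (auto simp: square_integrable_def)

lemmas [measurable_dest] = square_integrableD(1)

lemma integrable_mult_square_integrable:
  assumes "square_integrable N f" "square_integrable N g"
  shows "integrable N (\<lambda>x. f x * g x)"
proof (rule Bochner_Integration.integrable_bound)
  show "integrable N (\<lambda>x. (f x)\<^sup>2 + (g x)\<^sup>2)"
    using assms by (simp add: square_integrable_def)
  show "(\<lambda>x. f x * g x) \<in> borel_measurable N"
    using assms by measurable
  have "\<bar>f x * g x\<bar> \<le> (f x)\<^sup>2 + (g x)\<^sup>2" for x
    using sum_squares_bound[of "\<bar>f x\<bar>" "\<bar>g x\<bar>"] abs_ge_zero[of "f x * g x"]
    unfolding abs_mult power2_abs by linarith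
  thus "AE x in N. norm (f x * g x) \<le> norm ((f x)\<^sup>2 + (g x)\<^sup>2)" by simp
qed

lemma square_integrable_scale:
  assumes "square_integrable N f"
  shows "square_integrable N (\<lambda>x. c * f x)"
  unfolding square_integrable_def
  using assms square_integrableD(2)[OF assms] by (simp add: power_mult_distrib)

lemma square_integrable_add:
  assumes "square_integrable N f" "square_integrable N g"
  shows "square_integrable N (\<lambda>x. f x + g x)"
  unfolding square_integrable_def
  using assms integrable_mult_square_integrable[OF assms] assms[THEN square_integrableD(2)]
  by (simp add: power2_sum mult.assoc)

lemma square_integrable_diff:
  assumes "square_integrable N f" "square_integrable N g"
  shows "square_integrable N (\<lambda>x. f x - g x)"
  using square_integrable_add[OF assms(1) square_integrable_scale[OF assms(2), of "-1"]] by simp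

lemma square_integrable_sum:
  assumes "\<And>i. i \<in> I \<Longrightarrow> square_integrable N (f i)"
  shows "square_integrable N (\<lambda>x. \<Sum>i\<in>I. f i x)"
  using assms
proof (induction I rule: infinite_finite_induct)
  case (insert i I)
  thus ?case by (simp add: square_integrable_add)
qed (simp_all add: square_integrable_def)

lemma square_integrable_mult_bounded:
  assumes f: "square_integrable N f" and g: "g \<in> borel_measurable N" and bd: "\<And>x. x \<in> space N \<Longrightarrow> \<bar>g x\<bar> \<le> c"
  shows "square_integrable N (\<lambda>x. f x * g x)"
  unfolding square_integrable_def
proof
  show "(\<lambda>x. f x * g x) \<in> borel_measurable N" using f g by measurable
  show "integrable N (\<lambda>x. (f x * g x)\<^sup>2)"
  proof (rule Bochner_Integration.integrable_bound)
    show "integrable N (\<lambda>x. c\<^sup>2 * (f x)\<^sup>2)" using f by (simp add: square_integrable_def)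
    show "(\<lambda>x. (f x * g x)\<^sup>2) \<in> borel_measurable N" using f g by measurable
    show "AE x in N. norm ((f x * g x)\<^sup>2) \<le> norm (c\<^sup>2 * (f x)\<^sup>2)"
      using power_mono[OF bd abs_ge_zero, of _ 2]
      by (intro AE_I2) (simp add: power_mult_distrib mult.commute[of "c\<^sup>2"] mult_left_mono)
  qed
qed

lemma square_integrable_AE_cong:
  assumes "square_integrable N f" "g \<in> borel_measurable N" "AE x in N. f x = g x"
  shows "square_integrable N g"
proof -
  have "integrable N (\<lambda>x. (g x)\<^sup>2)"
    by (rule Bochner_Integration.integrable_bound[OF square_integrableD(2)[OF assms(1)]])
      (use assms in auto)
  thus ?thesis using assms(2) by (simp add: square_integrable_def)
qed

lemma (in finite_measure) integrable_if_square_integrable: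
  assumes "square_integrable M f"
  shows "integrable M f"
  using integrable_mult_square_integrable[OF assms, of "\<lambda>_. 1"] by (simp add: square_integrable_def)

text \<open>The polynomial \<open>h \<mapsto> \<integral>(f + h g)\<^sup>2\<close> is nonnegative, so its discriminant is not positive.\<close>

lemma Cauchy_Schwarz_lebesgue_integral:
  assumes "square_integrable N f" "square_integrable N g"
  shows "\<bar>\<integral>x. f x * g x \<partial>N\<bar> \<le> sqrt (\<integral>x. (f x)\<^sup>2 \<partial>N) * sqrt (\<integral>x. (g x)\<^sup>2 \<partial>N)"
proof -
  define a b c where "a = (\<integral>x. (f x)\<^sup>2 \<partial>N)" and "b = (\<integral>x. f x * g x \<partial>N)" and "c = (\<integral>x. (g x)\<^sup>2 \<partial>N)"
  have 0: "0 \<le> a" "0 \<le> c" by (simp_all add: a_def c_def)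
  have quad: "0 \<le> a + 2 * h * b + h\<^sup>2 * c" for h :: real
  proof -
    have "0 \<le> (\<integral>x. (f x + h * g x)\<^sup>2 \<partial>N)" by simp
    also have "\<dots> = (\<integral>x. (f x)\<^sup>2 + (2 * h * (f x * g x) + h\<^sup>2 * (g x)\<^sup>2) \<partial>N)"
      by (rule Bochner_Integration.integral_cong) (auto simp: power2_eq_square algebra_simps)
    also have "\<dots> = a + 2 * h * b + h\<^sup>2 * c"
      using assms integrable_mult_square_integrable[OF assms]
      by (simp add: square_integrable_def a_def b_def c_def)
    finally show ?thesis .
  qed
  have "b\<^sup>2 \<le> a * c"
  proof (cases "c = 0")
    case True
    have "b = 0"
    proof (rule ccontr)
      assume "b \<noteq> 0"
      thus False using quad[of "- (a + 1) / (2 * b)"] True by (simp add: field_simps)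
    qed
    thus ?thesis using 0 by simp
  next
    case False
    hence c: "c > 0" using 0 by simp
    have "0 \<le> c * (a + 2 * (- b / c) * b + (- b / c)\<^sup>2 * c)" using quad[of "- b / c"] c by simp
    also have "\<dots> = a * c - b\<^sup>2" using c by (simp add: field_simps power2_eq_square)
    finally show ?thesis by simp
  qed
  hence "\<bar>b\<bar> \<le> sqrt (a * c)" by (intro real_le_rsqrt) simp
  thus ?thesis by (simp add: a_def b_def c_def real_sqrt_mult)
qed

definition L2_tendsto :: "'a measure \<Rightarrow> (nat \<Rightarrow> 'a \<Rightarrow> real) \<Rightarrow> ('a \<Rightarrow> real) \<Rightarrow> bool" where
  "L2_tendsto N f g \<longleftrightarrow> (\<forall>n. square_integrable N (f n)) \<and> square_integrable N g \<and>
     (\<lambda>n. \<integral>x. (f n x - g x)\<^sup>2 \<partial>N) \<longlonglongrightarrow> 0"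

lemma L2_tendsto_inner:
  assumes f: "L2_tendsto N f f'" and g: "L2_tendsto N g g'"
  shows "(\<lambda>n. \<integral>x. f n x * g n x \<partial>N) \<longlonglongrightarrow> (\<integral>x. f' x * g' x \<partial>N)"
proof -
  note sq = f[unfolded L2_tendsto_def] g[unfolded L2_tendsto_def]
  define p where "p n = sqrt (\<integral>x. (f n x - f' x)\<^sup>2 \<partial>N)" for n
  define q where "q n = sqrt (\<integral>x. (g n x - g' x)\<^sup>2 \<partial>N)" for n
  have p: "p \<longlonglongrightarrow> 0" unfolding p_def using tendsto_real_sqrt[of _ 0] sq by fastforce
  have q: "q \<longlonglongrightarrow> 0" unfolding q_def using tendsto_real_sqrt[of _ 0] sq by fastforce
  have "(\<lambda>n. (\<integral>x. f n x * g n x \<partial>N) - (\<integral>x. f' x * g' x \<partial>N)) \<longlonglongrightarrow> 0"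
  proof (rule Lim_null_comparison)
    show "(\<lambda>n. p n * q n + p n * sqrt (\<integral>x. (g' x)\<^sup>2 \<partial>N) + sqrt (\<integral>x. (f' x)\<^sup>2 \<partial>N) * q n) \<longlonglongrightarrow> 0"
      using p q by (auto intro!: tendsto_eq_intros)
    show "\<forall>\<^sub>F n in sequentially. norm ((\<integral>x. f n x * g n x \<partial>N) - (\<integral>x. f' x * g' x \<partial>N)) \<le>
        p n * q n + p n * sqrt (\<integral>x. (g' x)\<^sup>2 \<partial>N) + sqrt (\<integral>x. (f' x)\<^sup>2 \<partial>N) * q n"
    proof (intro always_eventually allI)
      fix n
      have sf: "square_integrable N (\<lambda>x. f n x - f' x)" and sg: "square_integrable N (\<lambda>x. g n x - g' x)"
        and sf': "square_integrable N f'" and sg': "square_integrable N g'"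
        using sq by (auto intro: square_integrable_diff)
      note i = integrable_mult_square_integrable
      have "(\<integral>x. f n x * g n x \<partial>N) =
        (\<integral>x. (f n x - f' x) * (g n x - g' x) + ((f n x - f' x) * g' x + (f' x * (g n x - g' x) + f' x * g' x)) \<partial>N)"
        by (rule Bochner_Integration.integral_cong) (auto simp: algebra_simps)
      also have "\<dots> = (\<integral>x. (f n x - f' x) * (g n x - g' x) \<partial>N) + ((\<integral>x. (f n x - f' x) * g' x \<partial>N)
          + ((\<integral>x. f' x * (g n x - g' x) \<partial>N) + (\<integral>x. f' x * g' x \<partial>N)))"
        using i[OF sf sg] i[OF sf sg'] i[OF sf' sg] i[OF sf' sg']
        by (simp only: Bochner_Integration.integral_add Bochner_Integration.integrable_add)
      finally show "norm ((\<integral>x. f n x * g n x \<partial>N) - (\<integral>x. f' x * g' x \<partial>N)) \<le>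
        p n * q n + p n * sqrt (\<integral>x. (g' x)\<^sup>2 \<partial>N) + sqrt (\<integral>x. (f' x)\<^sup>2 \<partial>N) * q n"
        using Cauchy_Schwarz_lebesgue_integral[OF sf sg] Cauchy_Schwarz_lebesgue_integral[OF sf sg']
          Cauchy_Schwarz_lebesgue_integral[OF sf' sg]
        unfolding p_def q_def real_norm_def by linarith
    qed
  qed
  thus ?thesis by (simp add: LIM_zero_iff)
qed

text \<open>Convergence to zero of the extended nonnegative integrals makes one of them finite, and
  this already forces the limit \<open>g\<close> to be square integrable.\<close>

lemma L2_tendstoI_nn_integral:
  assumes f: "\<And>n. square_integrable N (f n)" and g: "g \<in> borel_measurable N"
    and lim: "(\<lambda>n. \<integral>\<^sup>+x. ennreal ((g x - f n x)\<^sup>2) \<partial>N) \<longlonglongrightarrow> 0"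
  shows "L2_tendsto N f g"
proof -
  have [measurable]: "f n \<in> borel_measurable N" for n using f by (simp add: square_integrable_def)
  note [measurable] = g
  have "\<forall>\<^sub>F n in sequentially. (\<integral>\<^sup>+x. ennreal ((g x - f n x)\<^sup>2) \<partial>N) < 1"
    using order_tendstoD(2)[OF lim, of 1] by simp
  then obtain n where "(\<integral>\<^sup>+x. ennreal ((g x - f n x)\<^sup>2) \<partial>N) < 1"
    by (auto simp: eventually_sequentially)
  hence "square_integrable N (\<lambda>x. g x - f n x)"
    unfolding square_integrable_def
    by (auto intro!: integrableI_bounded simp: less_top[symmetric] top_unique)
  from square_integrable_add[OF this f[of n]] have sg: "square_integrable N g" by simp
  have "ennreal (\<integral>x. (f k x - g x)\<^sup>2 \<partial>N) = (\<integral>\<^sup>+x. ennreal ((g x - f k x)\<^sup>2) \<partial>N)" for k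
    using square_integrableD(2)[OF square_integrable_diff[OF f sg], of k]
    by (subst nn_integral_eq_integral[symmetric]) (auto simp: power2_commute)
  hence "(\<lambda>n. ennreal (\<integral>x. (f n x - g x)\<^sup>2 \<partial>N)) \<longlonglongrightarrow> ennreal 0" using lim by simp
  hence "(\<lambda>n. \<integral>x. (f n x - g x)\<^sup>2 \<partial>N) \<longlonglongrightarrow> 0"
    by (subst (asm) tendsto_ennreal_iff) auto
  thus ?thesis using f sg by (simp add: L2_tendsto_def)
qed

lemma L2_tendsto_contraction_mult:
  assumes f: "L2_tendsto N f g" and r: "r \<in> borel_measurable N" "\<And>x. \<bar>r x\<bar> \<le> 1"
  shows "L2_tendsto N (\<lambda>n x. r x * f n x) (\<lambda>x. r x * g x)"
proof -
  note sq = f[unfolded L2_tendsto_def]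
  have mult: "square_integrable N (\<lambda>x. r x * h x)" if "square_integrable N h" for h :: "'a \<Rightarrow> real"
    using square_integrable_mult_bounded[OF that r] by (simp add: mult.commute)
  have "(\<lambda>n. \<integral>x. (r x * f n x - r x * g x)\<^sup>2 \<partial>N) \<longlonglongrightarrow> 0"
  proof (rule Lim_null_comparison)
    show "(\<lambda>n. \<integral>x. (f n x - g x)\<^sup>2 \<partial>N) \<longlonglongrightarrow> 0" using sq by simp
    have "(r x * y - r x * z)\<^sup>2 \<le> (y - z)\<^sup>2" for x y z
    proof -
      have "(r x)\<^sup>2 \<le> 1" using r(2)[of x] by (simp add: abs_square_le_1)
      from mult_right_mono[OF this, of "(y - z)\<^sup>2"] show ?thesis
        by (simp add: right_diff_distrib[symmetric] power_mult_distrib)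
    qed
    hence "(\<integral>x. (r x * f n x - r x * g x)\<^sup>2 \<partial>N) \<le> (\<integral>x. (f n x - g x)\<^sup>2 \<partial>N)" for n
      using sq by (intro integral_mono square_integrableD(2) square_integrable_diff mult) auto
    thus "\<forall>\<^sub>F n in sequentially. norm (\<integral>x. (r x * f n x - r x * g x)\<^sup>2 \<partial>N)
        \<le> (\<integral>x. (f n x - g x)\<^sup>2 \<partial>N)" by simp
  qed
  thus ?thesis using sq mult by (simp add: L2_tendsto_def)
qed

section \<open>Moments of Wiener increments\<close>

lemma (in prob_space) centred_normal_law_moments:
  assumes X: "X \<in> borel_measurable M" and law: "distr M borel X = normal_law 0 v" and v: "0 \<le> v"
  shows "square_integrable M X" and "expectation X = 0"
proof -
  have "integrable (normal_law 0 v) (\<lambda>y. y\<^sup>2) \<and> (\<integral>y. y \<partial>normal_law 0 v) = 0"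
  proof (cases "v = 0")
    case True
    have "integrable (return borel (0::real)) (\<lambda>y. y\<^sup>2)"
      by (rule integrableI_bounded) (auto simp: nn_integral_return)
    thus ?thesis using True by (simp add: normal_law_def integral_return)
  next
    case False
    define \<sigma> where "\<sigma> = sqrt v"
    have "normal_law 0 v = density lborel (normal_density 0 \<sigma>)" using False by (simp add: normal_law_def \<sigma>_def)
    thus ?thesis
      using integrable_normal_moment[of \<sigma> 0 2] integral_normal_moment_nz_1[of \<sigma> 0] v False
      by (simp add: integrable_density integral_density \<sigma>_def)
  qed
  thus "square_integrable M X" "expectation X = 0"
    unfolding law[symmetric] using X
    by (auto simp: integrable_distr_eq integral_distr square_integrable_def)
qed

context filtered_prob_space
begin

lemma filtration_space [simp]: "0 \<le> t \<Longrightarrow> space (F t) = space M"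
  using filtration_subalgebra by (simp add: subalgebra_def)

lemma measurable_filtration:
  assumes "f \<in> borel_measurable (F t)" "0 \<le> t"
  shows "f \<in> borel_measurable M"
  using measurable_from_subalg[OF filtration_subalgebra[OF assms(2)] assms(1)] .

lemma measurable_filtration_mono:
  assumes "f \<in> borel_measurable (F s)" "0 \<le> s" "s \<le> t"
  shows "f \<in> borel_measurable (F t)"
proof -
  have "subalgebra (F t) (F s)" using assms filtration_mono by (simp add: subalgebra_def)
  from measurable_from_subalg[OF this assms(1)] show ?thesis .
qed

end

context wiener_process
begin

lemma wiener_component_measurable:
  assumes "0 \<le> s" "s \<le> t"
  shows "(\<lambda>\<omega>. w s \<omega> $ i) \<in> borel_measurable (F t)"
  using measurable_compose[OF measurable_filtration_mono[OF wiener_adapted[OF assms(1)] assms]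
      borel_measurable_continuous_onI[OF continuous_on_component[OF continuous_on_id]]] by simp

lemma wiener_increment_measurable:
  assumes "0 \<le> s" "s \<le> t"
  shows "(\<lambda>\<omega>. w t \<omega> $ i - w s \<omega> $ i) \<in> borel_measurable (F t)"
  using wiener_component_measurable[of s t i] wiener_component_measurable[of t t i] assms by simp

lemma wiener_covariance_diag_nonneg: "0 \<le> K $ i $ i"
proof -
  have "0 \<le> expectation (\<lambda>\<omega>. w 1 \<omega> $ i * w 1 \<omega> $ i)" by simp
  thus ?thesis by (simp add: wiener_covariance)
qed

lemma covariance_symmetric: "K $ i $ j = K $ j $ i"
  using wiener_covariance[of 1 i j] wiener_covariance[of 1 j i] by (simp add: mult.commute)

lemma wiener_increment_moments:
  assumes "0 \<le> s" "s \<le> t"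
  shows "square_integrable M (\<lambda>\<omega>. w t \<omega> $ i - w s \<omega> $ i)"
    and "expectation (\<lambda>\<omega>. w t \<omega> $ i - w s \<omega> $ i) = 0"
proof -
  have "axis i 1 \<bullet> (K *v axis i 1) = K $ i $ i"
    by (simp add: inner_axis' matrix_vector_mult_basis column_def)
  moreover have "axis i 1 \<bullet> (w (s + (t - s)) \<omega> - w s \<omega>) = w t \<omega> $ i - w s \<omega> $ i" for \<omega>
    by (simp add: inner_axis')
  ultimately have law: "distr M borel (\<lambda>\<omega>. w t \<omega> $ i - w s \<omega> $ i) = normal_law 0 ((t - s) * K $ i $ i)"
    using wiener_gaussian_increments[of s "t - s" "axis i 1"] assms by simp
  have meas: "(\<lambda>\<omega>. w t \<omega> $ i - w s \<omega> $ i) \<in> borel_measurable M"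
    using measurable_filtration[OF wiener_increment_measurable[OF assms]] assms by simp
  have "0 \<le> (t - s) * K $ i $ i" using wiener_covariance_diag_nonneg[of i] assms by simp
  from centred_normal_law_moments[OF meas law this]
  show "square_integrable M (\<lambda>\<omega>. w t \<omega> $ i - w s \<omega> $ i)"
    and "expectation (\<lambda>\<omega>. w t \<omega> $ i - w s \<omega> $ i) = 0" .
qed

lemma expectation_past_mult_increment_function:
  assumes st: "0 \<le> s" "s \<le> t"
    and Z: "Z \<in> borel_measurable (F s)" "integrable M Z"
    and g: "g \<in> borel_measurable borel" "integrable M (\<lambda>\<omega>. g (w t \<omega> - w s \<omega>) :: real)"
  shows "integrable M (\<lambda>\<omega>. Z \<omega> * g (w t \<omega> - w s \<omega>))"
    and "expectation (\<lambda>\<omega>. Z \<omega> * g (w t \<omega> - w s \<omega>)) = expectation Z * expectation (\<lambda>\<omega>. g (w t \<omega> - w s \<omega>))"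
proof -
  have wm: "(\<lambda>\<omega>. w t \<omega> - w s \<omega>) \<in> borel_measurable M"
    using measurable_filtration[OF wiener_adapted] st by (intro borel_measurable_diff) simp_all
  have "indep_set (sets (F s)) (sets (vimage_algebra (space M) (\<lambda>\<omega>. w t \<omega> - w s \<omega>) borel))"
    using wiener_indep_increments[of s "t - s"] st by simp
  hence "indep_set (sigma_sets (space M) {Z -` A \<inter> space M | A. A \<in> sets borel})
      (sigma_sets (space M) {(\<lambda>\<omega>. g (w t \<omega> - w s \<omega>)) -` A \<inter> space M | A. A \<in> sets borel})"
    unfolding indep_set_def
  proof (rule indep_sets_mono_sets)
    have "sigma_sets (space M) {Z -` A \<inter> space M | A. A \<in> sets borel} \<subseteq> sets (F s)"
      using measurable_sets[OF Z(1)] st sets.sigma_sets_subset[of "{Z -` A \<inter> space M | A. A \<in> sets borel}" "F s"]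
      by auto
    moreover have "sigma_sets (space M) {(\<lambda>\<omega>. g (w t \<omega> - w s \<omega>)) -` A \<inter> space M | A. A \<in> sets borel}
        \<subseteq> sets (vimage_algebra (space M) (\<lambda>\<omega>. w t \<omega> - w s \<omega>) borel)"
    proof -
      let ?V = "vimage_algebra (space M) (\<lambda>\<omega>. w t \<omega> - w s \<omega>) borel"
      have "(\<lambda>\<omega>. w t \<omega> - w s \<omega>) \<in> borel_measurable ?V"
        by (rule measurable_vimage_algebra1) simp
      from measurable_compose[OF this g(1)]
      have "(\<lambda>\<omega>. g (w t \<omega> - w s \<omega>)) -` A \<inter> space M \<in> sets ?V" if "A \<in> sets borel" for A
        using measurable_sets[of _ ?V borel A] that by simp
      hence "{(\<lambda>\<omega>. g (w t \<omega> - w s \<omega>)) -` A \<inter> space M | A. A \<in> sets borel} \<subseteq> sets ?V" by auto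
      from sets.sigma_sets_subset[OF this] show ?thesis by simp
    qed
    ultimately show "case_bool (sigma_sets (space M) {Z -` A \<inter> space M | A. A \<in> sets borel})
      (sigma_sets (space M) {(\<lambda>\<omega>. g (w t \<omega> - w s \<omega>)) -` A \<inter> space M | A. A \<in> sets borel}) i
      \<subseteq> case_bool (sets (F s)) (sets (vimage_algebra (space M) (\<lambda>\<omega>. w t \<omega> - w s \<omega>) borel)) i" for i
      by (cases i) simp_all
  qed
  hence "indep_var borel Z borel (\<lambda>\<omega>. g (w t \<omega> - w s \<omega>))"
    unfolding indep_var_eq using Z g measurable_filtration st measurable_compose[OF wm g(1)] by auto
  from indep_var_integrable[OF this Z(2) g(2)] indep_var_lebesgue_integral[OF this Z(2) g(2)]
  show "integrable M (\<lambda>\<omega>. Z \<omega> * g (w t \<omega> - w s \<omega>))"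
    and "expectation (\<lambda>\<omega>. Z \<omega> * g (w t \<omega> - w s \<omega>)) = expectation Z * expectation (\<lambda>\<omega>. g (w t \<omega> - w s \<omega>))" .
qed

lemma expectation_past_mult_increment:
  assumes st: "0 \<le> s" "s \<le> t"
    and Z: "Z \<in> borel_measurable (F s)" "integrable M Z"
  shows "integrable M (\<lambda>\<omega>. Z \<omega> * (w t \<omega> $ i - w s \<omega> $ i))"
    and "expectation (\<lambda>\<omega>. Z \<omega> * (w t \<omega> $ i - w s \<omega> $ i)) = 0"
  using expectation_past_mult_increment_function[OF assms, of "\<lambda>y. y $ i"]
    wiener_increment_moments[OF st, of i] integrable_if_square_integrable
  by auto

lemma wiener_square_integrable:
  assumes "0 \<le> t"
  shows "square_integrable M (\<lambda>\<omega>. w t \<omega> $ i)"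
proof (rule square_integrable_AE_cong[OF wiener_increment_moments(1)])
  show "0 \<le> t" "(0::real) \<le> 0" using assms by simp_all
  show "(\<lambda>\<omega>. w t \<omega> $ i) \<in> borel_measurable M"
    using measurable_filtration[OF wiener_component_measurable] assms by blast
  show "AE \<omega> in M. w t \<omega> $ i - w 0 \<omega> $ i = w t \<omega> $ i"
    using wiener_start by eventually_elim simp
qed

text \<open>The mixed terms of the expansion vanish, because each of them is the product of
  an increment after time \<open>s\<close> with a component of \<open>w s\<close>.\<close>

lemma expectation_increment_mult_increment:
  assumes st: "0 \<le> s" "s \<le> t"
  shows "expectation (\<lambda>\<omega>. (w t \<omega> $ i - w s \<omega> $ i) * (w t \<omega> $ j - w s \<omega> $ j)) = K $ i $ j * (t - s)"
proof -
  have t: "0 \<le> t" using st by simp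
  have ws: "(\<lambda>\<omega>. w s \<omega> $ k) \<in> borel_measurable (F s)" "integrable M (\<lambda>\<omega>. w s \<omega> $ k)" for k
    using wiener_component_measurable wiener_square_integrable integrable_if_square_integrable st
    by auto
  note z = expectation_past_mult_increment[OF st ws]
  note i = integrable_mult_square_integrable[OF wiener_square_integrable[OF t, of i] wiener_square_integrable[OF t, of j]]
    integrable_mult_square_integrable[OF wiener_square_integrable[OF st(1), of i] wiener_square_integrable[OF st(1), of j]]
  have "expectation (\<lambda>\<omega>. (w t \<omega> $ i - w s \<omega> $ i) * (w t \<omega> $ j - w s \<omega> $ j)) =
    expectation (\<lambda>\<omega>. w t \<omega> $ i * w t \<omega> $ j - w s \<omega> $ i * w s \<omega> $ j
       - w s \<omega> $ i * (w t \<omega> $ j - w s \<omega> $ j) - w s \<omega> $ j * (w t \<omega> $ i - w s \<omega> $ i))"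
    by (rule Bochner_Integration.integral_cong) (auto simp: algebra_simps)
  also have "\<dots> = K $ i $ j * t - K $ i $ j * s"
    using i z by (simp only: Bochner_Integration.integral_diff Bochner_Integration.integrable_diff
        wiener_covariance[OF t] wiener_covariance[OF st(1)] diff_zero)
  finally show ?thesis by (simp add: algebra_simps)
qed

lemma expectation_past_mult_two_increments:
  assumes st: "0 \<le> s" "s \<le> t"
    and Z: "Z \<in> borel_measurable (F s)" "integrable M Z"
  shows "expectation (\<lambda>\<omega>. Z \<omega> * ((w t \<omega> $ i - w s \<omega> $ i) * (w t \<omega> $ j - w s \<omega> $ j)))
      = K $ i $ j * (t - s) * expectation Z"
  using expectation_past_mult_increment_function(2)[OF assms, of "\<lambda>y. y $ i * y $ j"]
    integrable_mult_square_integrable[OF wiener_increment_moments(1)[OF st, of i] wiener_increment_moments(1)[OF st, of j]]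
    expectation_increment_mult_increment[OF st]
  by (simp add: mult.commute)

text \<open>As \<open>K = E[w(1) w(1)\<^sup>T]\<close>, the sum is the expectation of the quadratic form of \<open>S\<close> at the
  random vector \<open>\<Sum>i. w\<^sub>i(1) g\<^sub>i\<close>. This is where the noise part of the Lyapunov operator is seen
  to preserve positivity.\<close>

lemma covariance_weighted_form_nonneg:
  fixes g :: "'q \<Rightarrow> real ^ 'n"
  assumes "positive_semidefinite S"
  shows "0 \<le> (\<Sum>i\<in>UNIV. \<Sum>j\<in>UNIV. K $ i $ j * (g i \<bullet> (S *v g j)))"
proof -
  have int: "integrable M (\<lambda>\<omega>. w 1 \<omega> $ i * w 1 \<omega> $ j)" for i j
    by (intro integrable_mult_square_integrable wiener_square_integrable) simp_all
  have "0 \<le> expectation (\<lambda>\<omega>. (\<Sum>i\<in>UNIV. w 1 \<omega> $ i *\<^sub>R g i) \<bullet> (S *v (\<Sum>i\<in>UNIV. w 1 \<omega> $ i *\<^sub>R g i)))"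
    using assms by (intro Bochner_Integration.integral_nonneg) (simp add: positive_semidefinite_def)
  also have "\<dots> = expectation (\<lambda>\<omega>. \<Sum>i\<in>UNIV. \<Sum>j\<in>UNIV. (g i \<bullet> (S *v g j)) * (w 1 \<omega> $ i * w 1 \<omega> $ j))"
    by (subst sum.swap)
       (simp add: linear_sum[OF matrix_vector_mul_linear] inner_sum_left inner_sum_right
        matrix_vector_mult_scaleR ac_simps sum_distrib_left)
  also have "\<dots> = (\<Sum>i\<in>UNIV. \<Sum>j\<in>UNIV. K $ i $ j * (g i \<bullet> (S *v g j)))"
    using int wiener_covariance[of 1] by (simp add: mult.commute)
  finally show ?thesis .
qed

end

section \<open>Elementary integrands\<close>

text \<open>An elementary integrand is a sum of terms \<open>1_(a k, b k] \<phi> k\<close> over arbitrary, possibly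
  overlapping or empty intervals. Compared with a partition of the time axis this makes both the
  product of two integrands and the restriction to an earlier time interval purely termwise.\<close>

definition elementary_process ::
  "nat \<Rightarrow> (nat \<Rightarrow> real) \<Rightarrow> (nat \<Rightarrow> real) \<Rightarrow> (nat \<Rightarrow> 'a \<Rightarrow> real) \<Rightarrow> real \<times> 'a \<Rightarrow> real" where
  "elementary_process m a b \<phi> z = (\<Sum>k<m. indicator {a k<..b k} (fst z) * \<phi> k (snd z))"

context prob_space
begin

interpretation path: pair_sigma_finite lborel M ..

lemma integral_indicator_times:
  assumes "integrable M \<psi>" and [measurable]: "A \<in> sets borel" and fin: "emeasure lborel A < \<infinity>"
  shows "integrable (lborel \<Otimes>\<^sub>M M) (\<lambda>z. indicator A (fst z) * \<psi> (snd z))"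
    and "(\<integral>z. indicator A (fst z) * \<psi> (snd z) \<partial>(lborel \<Otimes>\<^sub>M M)) = measure lborel A * expectation \<psi>"
proof -
  have [measurable]: "\<psi> \<in> borel_measurable M" using assms by simp
  show int: "integrable (lborel \<Otimes>\<^sub>M M) (\<lambda>z. indicator A (fst z) * \<psi> (snd z))"
  proof (rule path.Fubini_integrable)
    show "(\<lambda>z. indicator A (fst z) * \<psi> (snd z)) \<in> borel_measurable (lborel \<Otimes>\<^sub>M M)" by measurable
    have "(\<lambda>x. \<integral>y. norm (indicator A (fst (x, y)) * \<psi> (snd (x, y))) \<partial>M)
        = (\<lambda>x. indicator A x * (\<integral>y. \<bar>\<psi> y\<bar> \<partial>M))" by (simp add: abs_mult)
    thus "integrable lborel (\<lambda>x. \<integral>y. norm (indicator A (fst (x, y)) * \<psi> (snd (x, y))) \<partial>M)"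
      using fin by simp
    show "AE x in lborel. integrable M (\<lambda>y. indicator A (fst (x, y)) * \<psi> (snd (x, y)))"
      using assms(1) by simp
  qed
  show "(\<integral>z. indicator A (fst z) * \<psi> (snd z) \<partial>(lborel \<Otimes>\<^sub>M M)) = measure lborel A * expectation \<psi>"
    using path.integral_fst'[OF int] fin by simp
qed

end

context wiener_process
begin

definition elementary ::
  "nat \<Rightarrow> (nat \<Rightarrow> real) \<Rightarrow> (nat \<Rightarrow> real) \<Rightarrow> (nat \<Rightarrow> 'a \<Rightarrow> real) \<Rightarrow> bool" where
  "elementary m a b \<phi> \<longleftrightarrow> (\<forall>k<m. 0 \<le> a k \<and> a k \<le> b k \<and>
     \<phi> k \<in> borel_measurable (F (a k)) \<and> bounded (\<phi> k ` space M))"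

definition elementary_integral ::
  "'q \<Rightarrow> nat \<Rightarrow> (nat \<Rightarrow> real) \<Rightarrow> (nat \<Rightarrow> real) \<Rightarrow> (nat \<Rightarrow> 'a \<Rightarrow> real) \<Rightarrow> 'a \<Rightarrow> real" where
  "elementary_integral i m a b \<phi> \<omega> = (\<Sum>k<m. \<phi> k \<omega> * (w (b k) \<omega> $ i - w (a k) \<omega> $ i))"

interpretation path: pair_sigma_finite lborel M ..

lemma bounded_measurable_square_integrable:
  assumes "\<phi> \<in> borel_measurable M" "bounded (\<phi> ` space M)"
  shows "square_integrable M \<phi>"
proof -
  obtain c where c: "\<And>\<omega>. \<omega> \<in> space M \<Longrightarrow> \<bar>\<phi> \<omega>\<bar> \<le> c"
    using assms(2) by (auto simp: bounded_iff)
  have "square_integrable M (\<lambda>_. 1)" by (simp add: square_integrable_def)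
  from square_integrable_mult_bounded[OF this assms(1) c] show ?thesis by simp
qed

lemma square_integrable_bounded_mult:
  assumes "square_integrable M X" "\<phi> \<in> borel_measurable M" "bounded (\<phi> ` space M)"
  shows "square_integrable M (\<lambda>\<omega>. \<phi> \<omega> * X \<omega>)"
proof -
  obtain c where c: "\<And>\<omega>. \<omega> \<in> space M \<Longrightarrow> \<bar>\<phi> \<omega>\<bar> \<le> c"
    using assms(3) by (auto simp: bounded_iff)
  show ?thesis
    using square_integrable_mult_bounded[OF assms(1,2) c] by (simp add: mult.commute)
qed

lemma weighted_increment_square_integrable:
  assumes "0 \<le> a" "a \<le> b" "\<phi> \<in> borel_measurable (F a)" "bounded (\<phi> ` space M)"
  shows "square_integrable M (\<lambda>\<omega>. \<phi> \<omega> * (w b \<omega> $ i - w a \<omega> $ i))"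
  using square_integrable_bounded_mult[OF wiener_increment_moments(1)[OF assms(1,2)]
      measurable_filtration[OF assms(3,1)] assms(4)] .

text \<open>If \<open>(a, b]\<close> lies before \<open>c\<close>, the increment over \<open>(c, d]\<close> is independent of all the other
  factors and has mean zero. Otherwise both increments are cut at \<open>c\<close> and at the end
  \<open>e = min b d\<close> of the common interval \<open>(c, e]\<close>; of the products that arise, only the one of the
  two increments over \<open>(c, e]\<close> has a nonzero expectation.\<close>

lemma expectation_weighted_increments_ordered:
  assumes a: "0 \<le> a" "a \<le> b" "\<phi> \<in> borel_measurable (F a)" "bounded (\<phi> ` space M)"
    and c: "0 \<le> c" "c \<le> d" "\<psi> \<in> borel_measurable (F c)" "bounded (\<psi> ` space M)"
    and ac: "a \<le> c"
  shows "expectation (\<lambda>\<omega>. (\<phi> \<omega> * (w b \<omega> $ i - w a \<omega> $ i)) * (\<psi> \<omega> * (w d \<omega> $ j - w c \<omega> $ j)))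
    = K $ i $ j * measure lborel ({a<..b} \<inter> {c<..d}) * expectation (\<lambda>\<omega>. \<phi> \<omega> * \<psi> \<omega>)"
proof -
  define W where "W s t k \<omega> = w t \<omega> $ k - w s \<omega> $ k" for s t k \<omega>
  have \<phi>c: "\<phi> \<in> borel_measurable (F c)" using measurable_filtration_mono[OF a(3,1) ac] .
  have sW: "square_integrable M (W s t k)" if "0 \<le> s" "s \<le> t" for s t k
    unfolding W_def[abs_def] by (rule wiener_increment_moments(1)[OF that])
  have mW: "W s t k \<in> borel_measurable (F r)" if "0 \<le> s" "s \<le> t" "t \<le> r" for s t k r
    unfolding W_def[abs_def]
    by (rule measurable_filtration_mono[OF wiener_increment_measurable[OF that(1,2)] order_trans[OF that(1,2)] that(3)])
  have s\<psi>W: "square_integrable M (\<lambda>\<omega>. \<psi> \<omega> * W s t k \<omega>)" if "0 \<le> s" "s \<le> t" for s t k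
    using square_integrable_bounded_mult[OF sW[OF that] measurable_filtration[OF c(3,1)] c(4)] .
  have s\<phi>W: "square_integrable M (\<lambda>\<omega>. \<phi> \<omega> * W s t k \<omega>)" if "0 \<le> s" "s \<le> t" for s t k
    using square_integrable_bounded_mult[OF sW[OF that] measurable_filtration[OF a(3,1)] a(4)] .
  have s\<phi>: "square_integrable M \<phi>" and s\<psi>: "square_integrable M \<psi>"
    using bounded_measurable_square_integrable[OF measurable_filtration[OF a(3,1)] a(4)]
      bounded_measurable_square_integrable[OF measurable_filtration[OF c(3,1)] c(4)] .
  note int = integrable_mult_square_integrable
  \<comment> \<open>the source of the vanishing expectations below: increments after time \<open>r\<close> are orthogonal to the past\<close>
  have zero: "expectation (\<lambda>\<omega>. Z \<omega> * W r t k \<omega>) = 0" "integrable M (\<lambda>\<omega>. Z \<omega> * W r t k \<omega>)"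
    if "0 \<le> r" "r \<le> t" "Z \<in> borel_measurable (F r)" "integrable M Z" for Z r t k
    unfolding W_def by (rule expectation_past_mult_increment[OF that])+
  show ?thesis
  proof (cases "b \<le> c")
    case True
    have "(\<lambda>\<omega>. (\<phi> \<omega> * W a b i \<omega>) * \<psi> \<omega>) \<in> borel_measurable (F c)"
      by (intro borel_measurable_times \<phi>c c(3) mW a(1,2) True)
    from zero(1)[OF c(1,2) this int[OF s\<phi>W[OF a(1,2)] s\<psi>]]
    have "expectation (\<lambda>\<omega>. ((\<phi> \<omega> * W a b i \<omega>) * \<psi> \<omega>) * W c d j \<omega>) = 0" .
    hence "expectation (\<lambda>\<omega>. (\<phi> \<omega> * W a b i \<omega>) * (\<psi> \<omega> * W c d j \<omega>)) = 0"
      by (simp only: mult.assoc)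
    moreover have "{a<..b} \<inter> {c<..d} = {}" using True by auto
    ultimately show ?thesis unfolding W_def by (simp only: measure_empty mult_zero_left mult_zero_right)
  next
    case False
    define e where "e = min b d"
    have e: "c \<le> e" "e \<le> b" "e \<le> d" "0 \<le> e" using False c by (auto simp: e_def)
    have "{a<..b} \<inter> {c<..d} = {c<..e}" using ac by (auto simp: e_def)
    hence len: "measure lborel ({a<..b} \<inter> {c<..d}) = e - c" using e by simp
    have meas_e: "\<phi> \<in> borel_measurable (F e)" "\<psi> \<in> borel_measurable (F e)"
      using measurable_filtration_mono[OF \<phi>c c(1) e(1)] measurable_filtration_mono[OF c(3,1) e(1)] .
    have "(\<lambda>\<omega>. (\<phi> \<omega> * W a c i \<omega>) * \<psi> \<omega>) \<in> borel_measurable (F c)"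
      by (intro borel_measurable_times \<phi>c c(3) mW a(1) ac order_refl)
    note z1 = zero[OF c(1,2) this int[OF s\<phi>W[OF a(1) ac] s\<psi>], of j]
    have "(\<lambda>\<omega>. (\<phi> \<omega> * W c e i \<omega>) * \<psi> \<omega>) \<in> borel_measurable (F e)"
      by (intro borel_measurable_times meas_e mW c(1) e(1) order_refl)
    note z2 = zero[OF e(4,3) this int[OF s\<phi>W[OF c(1) e(1)] s\<psi>], of j]
    have "(\<lambda>\<omega>. \<phi> \<omega> * (\<psi> \<omega> * W c e j \<omega>)) \<in> borel_measurable (F e)"
      by (intro borel_measurable_times meas_e mW c(1) e(1) order_refl)
    note z3 = zero[OF e(4,2) this int[OF s\<phi> s\<psi>W[OF c(1) e(1)]], of i]
    have z4: "expectation (\<lambda>\<omega>. (\<phi> \<omega> * \<psi> \<omega>) * (W c e i \<omega> * W c e j \<omega>))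
        = K $ i $ j * (e - c) * expectation (\<lambda>\<omega>. \<phi> \<omega> * \<psi> \<omega>)"
      unfolding W_def
      using expectation_past_mult_two_increments[OF c(1) e(1) borel_measurable_times[OF \<phi>c c(3)] int[OF s\<phi> s\<psi>]] .
    have i4: "integrable M (\<lambda>\<omega>. (\<phi> \<omega> * \<psi> \<omega>) * (W c e i \<omega> * W c e j \<omega>))"
      using int[OF s\<phi>W[OF c(1) e(1), of i] s\<psi>W[OF c(1) e(1), of j]] by (simp add: ac_simps)
    \<comment> \<open>one of the increments over \<open>(e, b]\<close> and \<open>(e, d]\<close> vanishes\<close>
    have ebd: "W e b i \<omega> * W e d j \<omega> = 0" for \<omega> by (auto simp: W_def e_def min_def)
    have split: "(\<phi> \<omega> * W a b i \<omega>) * (\<psi> \<omega> * W c d j \<omega>) =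
        ((\<phi> \<omega> * W a c i \<omega>) * \<psi> \<omega>) * W c d j \<omega> + (((\<phi> \<omega> * W c e i \<omega>) * \<psi> \<omega>) * W e d j \<omega>
        + ((\<phi> \<omega> * (\<psi> \<omega> * W c e j \<omega>)) * W e b i \<omega> + (\<phi> \<omega> * \<psi> \<omega>) * (W c e i \<omega> * W c e j \<omega>)))" for \<omega>
    proof -
      define x1 x2 x3 y1 y2 where "x1 = W a c i \<omega>" and "x2 = W c e i \<omega>" and "x3 = W e b i \<omega>"
        and "y1 = W c e j \<omega>" and "y2 = W e d j \<omega>"
      have "W a b i \<omega> = x1 + x2 + x3" "W c d j \<omega> = y1 + y2" "x3 * y2 = 0"
        using ebd[of \<omega>] by (simp_all add: x1_def x2_def x3_def y1_def y2_def W_def)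
      thus ?thesis unfolding x1_def[symmetric] x2_def[symmetric] x3_def[symmetric] y1_def[symmetric] y2_def[symmetric]
        by algebra
    qed
    have "expectation (\<lambda>\<omega>. (\<phi> \<omega> * W a b i \<omega>) * (\<psi> \<omega> * W c d j \<omega>))
        = K $ i $ j * (e - c) * expectation (\<lambda>\<omega>. \<phi> \<omega> * \<psi> \<omega>)"
      unfolding split
      by (simp only: Bochner_Integration.integral_add Bochner_Integration.integrable_add z1 z2 z3 z4 i4 add_0_left)
    thus ?thesis using len by (simp add: W_def)
  qed
qed

lemma expectation_weighted_increments:
  assumes a: "0 \<le> a" "a \<le> b" "\<phi> \<in> borel_measurable (F a)" "bounded (\<phi> ` space M)"
    and c: "0 \<le> c" "c \<le> d" "\<psi> \<in> borel_measurable (F c)" "bounded (\<psi> ` space M)"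
  shows "expectation (\<lambda>\<omega>. (\<phi> \<omega> * (w b \<omega> $ i - w a \<omega> $ i)) * (\<psi> \<omega> * (w d \<omega> $ j - w c \<omega> $ j)))
    = K $ i $ j * measure lborel ({a<..b} \<inter> {c<..d}) * expectation (\<lambda>\<omega>. \<phi> \<omega> * \<psi> \<omega>)"
proof (cases "a \<le> c")
  case True
  thus ?thesis by (rule expectation_weighted_increments_ordered[OF a c])
next
  case False
  have swap: "(\<phi> \<omega> * (w b \<omega> $ i - w a \<omega> $ i)) * (\<psi> \<omega> * (w d \<omega> $ j - w c \<omega> $ j))
      = (\<psi> \<omega> * (w d \<omega> $ j - w c \<omega> $ j)) * (\<phi> \<omega> * (w b \<omega> $ i - w a \<omega> $ i))"
    "\<phi> \<omega> * \<psi> \<omega> = \<psi> \<omega> * \<phi> \<omega>" for \<omega>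
    by (rule mult.commute)+
  show ?thesis
    unfolding swap covariance_symmetric[of i j] Int_commute[of "{a<..b}"]
    by (rule expectation_weighted_increments_ordered[OF c a]) (use False in simp)
qed

lemma integral_interval_times:
  assumes "integrable M \<psi>"
  shows "integrable (lborel \<Otimes>\<^sub>M M) (\<lambda>z. indicator ({a<..b} \<inter> {c<..d}) (fst z) * \<psi> (snd z))"
    and "(\<integral>z. indicator ({a<..b} \<inter> {c<..d}) (fst z) * \<psi> (snd z) \<partial>(lborel \<Otimes>\<^sub>M M))
      = measure lborel ({a<..b} \<inter> {c<..d::real}) * expectation \<psi>"
proof -
  have "emeasure lborel {max a c<..min b d} < \<infinity>" by (cases "max a c \<le> min b d") auto
  moreover have "{a<..b} \<inter> {c<..d} = {max a c<..min b d}" by auto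
  ultimately have "emeasure lborel ({a<..b} \<inter> {c<..d}) < \<infinity>" by simp
  from integral_indicator_times[OF assms _ this]
  show "integrable (lborel \<Otimes>\<^sub>M M) (\<lambda>z. indicator ({a<..b} \<inter> {c<..d}) (fst z) * \<psi> (snd z))"
    and "(\<integral>z. indicator ({a<..b} \<inter> {c<..d}) (fst z) * \<psi> (snd z) \<partial>(lborel \<Otimes>\<^sub>M M))
      = measure lborel ({a<..b} \<inter> {c<..d::real}) * expectation \<psi>" by simp_all
qed

lemma elementaryD:
  assumes "elementary m a b \<phi>" "k < m"
  shows "0 \<le> a k" "a k \<le> b k" "\<phi> k \<in> borel_measurable (F (a k))" "bounded (\<phi> k ` space M)"
    "\<phi> k \<in> borel_measurable M" "square_integrable M (\<phi> k)"
proof -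
  show *: "0 \<le> a k" "a k \<le> b k" "\<phi> k \<in> borel_measurable (F (a k))" "bounded (\<phi> k ` space M)"
    using assms unfolding elementary_def by blast+
  show **: "\<phi> k \<in> borel_measurable M" by (rule measurable_filtration[OF *(3,1)])
  show "square_integrable M (\<phi> k)" by (rule bounded_measurable_square_integrable[OF ** *(4)])
qed

lemma elementary_process_square_integrable:
  assumes "elementary m a b \<phi>"
  shows "square_integrable (lborel \<Otimes>\<^sub>M M) (elementary_process m a b \<phi>)"
proof -
  have "square_integrable (lborel \<Otimes>\<^sub>M M) (\<lambda>z. indicator {a k<..b k} (fst z) * \<phi> k (snd z))" if "k < m" for k
    unfolding square_integrable_def
  proof
    note [measurable] = elementaryD(5)[OF assms that]
    show "(\<lambda>z. indicator {a k<..b k} (fst z) * \<phi> k (snd z)) \<in> borel_measurable (lborel \<Otimes>\<^sub>M M)" by measurable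
    have "(indicator {a k<..b k} (fst z) * \<phi> k (snd z))\<^sup>2 =
        indicator ({a k<..b k} \<inter> {a k<..b k}) (fst z) * (\<phi> k (snd z))\<^sup>2" for z
      by (auto simp: indicator_def)
    thus "integrable (lborel \<Otimes>\<^sub>M M) (\<lambda>z. (indicator {a k<..b k} (fst z) * \<phi> k (snd z))\<^sup>2)"
      by (simp only: integral_interval_times(1)[OF square_integrableD(2)[OF elementaryD(6)[OF assms that]]])
  qed
  thus ?thesis unfolding elementary_process_def[abs_def] by (intro square_integrable_sum) simp
qed

lemma elementary_integral_square_integrable:
  assumes "elementary m a b \<phi>"
  shows "square_integrable M (elementary_integral i m a b \<phi>)"
  unfolding elementary_integral_def[abs_def]
  using elementaryD[OF assms] by (intro square_integrable_sum weighted_increment_square_integrable) auto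

lemma integral_double_sum:
  fixes f :: "nat \<Rightarrow> nat \<Rightarrow> 'z \<Rightarrow> real"
  assumes "\<And>k l. k < m \<Longrightarrow> l < n \<Longrightarrow> integrable N (f k l)"
  shows "(\<integral>x. (\<Sum>k<m. \<Sum>l<n. f k l x) \<partial>N) = (\<Sum>k<m. \<Sum>l<n. (\<integral>x. f k l x \<partial>N))"
proof -
  have "integrable N (\<lambda>x. \<Sum>l<n. f k l x)" if "k \<in> {..<m}" for k
    using assms that by (intro Bochner_Integration.integrable_sum) simp
  hence "(\<integral>x. (\<Sum>k<m. \<Sum>l<n. f k l x) \<partial>N) = (\<Sum>k<m. (\<integral>x. (\<Sum>l<n. f k l x) \<partial>N))"
    by (rule Bochner_Integration.integral_sum)
  also have "\<dots> = (\<Sum>k<m. \<Sum>l<n. (\<integral>x. f k l x \<partial>N))"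
    using assms by (intro sum.cong refl Bochner_Integration.integral_sum) simp
  finally show ?thesis .
qed

lemma elementary_isometry:
  assumes e: "elementary m a b \<phi>" and e': "elementary m' a' b' \<phi>'"
  shows "expectation (\<lambda>\<omega>. elementary_integral i m a b \<phi> \<omega> * elementary_integral j m' a' b' \<phi>' \<omega>)
    = K $ i $ j * (\<integral>z. elementary_process m a b \<phi> z * elementary_process m' a' b' \<phi>' z \<partial>(lborel \<Otimes>\<^sub>M M))"
proof -
  note D = elementaryD[OF e] and D' = elementaryD[OF e']
  let ?c = "\<lambda>k l. measure lborel ({a k<..b k} \<inter> {a' l<..b' l}) * expectation (\<lambda>\<omega>. \<phi> k \<omega> * \<phi>' l \<omega>)"
  have int: "integrable M (\<lambda>\<omega>. (\<phi> k \<omega> * (w (b k) \<omega> $ i - w (a k) \<omega> $ i)) * (\<phi>' l \<omega> * (w (b' l) \<omega> $ j - w (a' l) \<omega> $ j)))"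
    if "k < m" "l < m'" for k l
    by (intro integrable_mult_square_integrable weighted_increment_square_integrable D[OF that(1)] D'[OF that(2)])
  have int': "integrable (lborel \<Otimes>\<^sub>M M) (\<lambda>z. indicator ({a k<..b k} \<inter> {a' l<..b' l}) (fst z) * (\<phi> k (snd z) * \<phi>' l (snd z)))"
    if "k < m" "l < m'" for k l
    by (intro integral_interval_times integrable_mult_square_integrable D[OF that(1)] D'[OF that(2)])
  have "expectation (\<lambda>\<omega>. elementary_integral i m a b \<phi> \<omega> * elementary_integral j m' a' b' \<phi>' \<omega>)
    = expectation (\<lambda>\<omega>. \<Sum>k<m. \<Sum>l<m'. (\<phi> k \<omega> * (w (b k) \<omega> $ i - w (a k) \<omega> $ i)) * (\<phi>' l \<omega> * (w (b' l) \<omega> $ j - w (a' l) \<omega> $ j)))"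
    by (simp add: elementary_integral_def sum_product)
  also have "\<dots> = (\<Sum>k<m. \<Sum>l<m'. expectation (\<lambda>\<omega>. (\<phi> k \<omega> * (w (b k) \<omega> $ i - w (a k) \<omega> $ i)) * (\<phi>' l \<omega> * (w (b' l) \<omega> $ j - w (a' l) \<omega> $ j))))"
    by (rule integral_double_sum[OF int])
  also have "\<dots> = (\<Sum>k<m. \<Sum>l<m'. K $ i $ j * measure lborel ({a k<..b k} \<inter> {a' l<..b' l}) * expectation (\<lambda>\<omega>. \<phi> k \<omega> * \<phi>' l \<omega>))"
    by (intro sum.cong refl expectation_weighted_increments[OF D(1,2,3,4) D'(1,2,3,4)]) simp_all
  also have "\<dots> = K $ i $ j * (\<Sum>k<m. \<Sum>l<m'. ?c k l)"
    by (simp only: sum_distrib_left mult.assoc)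
  also have "(\<Sum>k<m. \<Sum>l<m'. ?c k l) = (\<Sum>k<m. \<Sum>l<m'. (\<integral>z. indicator ({a k<..b k} \<inter> {a' l<..b' l}) (fst z) * (\<phi> k (snd z) * \<phi>' l (snd z)) \<partial>(lborel \<Otimes>\<^sub>M M)))"
    by (intro sum.cong refl integral_interval_times(2)[OF integrable_mult_square_integrable[OF D(6) D'(6)], symmetric])
       simp_all
  also have "\<dots> = (\<integral>z. (\<Sum>k<m. \<Sum>l<m'. indicator ({a k<..b k} \<inter> {a' l<..b' l}) (fst z) * (\<phi> k (snd z) * \<phi>' l (snd z))) \<partial>(lborel \<Otimes>\<^sub>M M))"
    by (rule integral_double_sum[OF int', symmetric])
  also have "\<dots> = (\<integral>z. elementary_process m a b \<phi> z * elementary_process m' a' b' \<phi>' z \<partial>(lborel \<Otimes>\<^sub>M M))"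
    by (simp only: elementary_process_def sum_product indicator_inter_arith mult.assoc mult.left_commute)
  finally show ?thesis .
qed

end

section \<open>The Ito integral as a mean square limit\<close>

context wiener_process
begin

interpretation path: pair_sigma_finite lborel M ..

text \<open>Restriction of an elementary integrand to the times up to \<open>s\<close>. A coefficient of an interval
  that starts after \<open>s\<close> must be replaced by \<open>0\<close>, as it may fail to be measurable at the new left
  end point \<open>s\<close>.\<close>

lemma elementary_truncate:
  assumes e: "elementary m a b \<phi>" and s: "0 \<le> s"
  shows "elementary m (\<lambda>k. min (a k) s) (\<lambda>k. min (b k) s) (\<lambda>k \<omega>. if a k \<le> s then \<phi> k \<omega> else 0)"
  unfolding elementary_def
proof (intro allI impI conjI)
  fix k assume k: "k < m"
  note D = elementaryD[OF e k]
  show "0 \<le> min (a k) s" "min (a k) s \<le> min (b k) s" using D(1,2) s by auto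
  show "(\<lambda>\<omega>. if a k \<le> s then \<phi> k \<omega> else 0) \<in> borel_measurable (F (min (a k) s))"
    using D(3) by (cases "a k \<le> s") (simp_all add: min_def)
  have "(\<lambda>\<omega>. if a k \<le> s then \<phi> k \<omega> else 0) ` space M \<subseteq> insert 0 (\<phi> k ` space M)" by auto
  moreover have "bounded (insert 0 (\<phi> k ` space M))" using D(4) by simp
  ultimately show "bounded ((\<lambda>\<omega>. if a k \<le> s then \<phi> k \<omega> else 0) ` space M)"
    by (rule bounded_subset[rotated])
qed

lemma elementary_process_truncate:
  "elementary_process m (\<lambda>k. min (a k) s) (\<lambda>k. min (b k) s) (\<lambda>k \<omega>. if a k \<le> s then \<phi> k \<omega> else 0) z
    = indicator {..s} (fst z) * elementary_process m a b \<phi> z"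
  unfolding elementary_process_def sum_distrib_left
  by (intro sum.cong refl) (auto simp: indicator_def)

text \<open>The martingale property, tested against random variables \<open>Z\<close> known at time \<open>s\<close>: the part
  of each term that lies after \<open>s\<close> is a coefficient times a later increment.\<close>

lemma expectation_past_mult_elementary_integral:
  assumes e: "elementary m a b \<phi>" and s: "0 \<le> s"
    and Z: "Z \<in> borel_measurable (F s)" "square_integrable M Z"
  shows "expectation (\<lambda>\<omega>. Z \<omega> * elementary_integral i m a b \<phi> \<omega>) =
    expectation (\<lambda>\<omega>. Z \<omega> * elementary_integral i m (\<lambda>k. min (a k) s) (\<lambda>k. min (b k) s)
      (\<lambda>k \<omega>. if a k \<le> s then \<phi> k \<omega> else 0) \<omega>)" (is "?L = ?R")
proof -
  let ?\<phi> = "\<lambda>k \<omega>. if a k \<le> s then \<phi> k \<omega> else 0"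
  let ?X = "\<lambda>k \<omega>. Z \<omega> * (\<phi> k \<omega> * (w (b k) \<omega> $ i - w (a k) \<omega> $ i))"
  let ?Y = "\<lambda>k \<omega>. Z \<omega> * (?\<phi> k \<omega> * (w (min (b k) s) \<omega> $ i - w (min (a k) s) \<omega> $ i))"
  note e' = elementary_truncate[OF e s]
  have iX: "integrable M (?X k)" if "k < m" for k
    by (intro integrable_mult_square_integrable Z weighted_increment_square_integrable elementaryD[OF e that])
  have iY: "integrable M (?Y k)" if "k < m" for k
    by (rule integrable_mult_square_integrable[OF Z(2) weighted_increment_square_integrable[OF elementaryD(1-4)[OF e' that]]])
  have eq: "expectation (?X k) = expectation (?Y k)" if "k < m" for k
  proof -
    note D = elementaryD[OF e that]
    have int: "integrable M (\<lambda>\<omega>. Z \<omega> * \<phi> k \<omega>)"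
      by (rule integrable_mult_square_integrable[OF Z(2) D(6)])
    consider "b k \<le> s" | "a k \<le> s" "s < b k" | "s < a k" by linarith
    thus ?thesis
    proof cases
      case 1
      thus ?thesis using D(2) by (simp add: min_absorb1)
    next
      case 2
      have m: "(\<lambda>\<omega>. Z \<omega> * \<phi> k \<omega>) \<in> borel_measurable (F s)"
        by (intro borel_measurable_times Z measurable_filtration_mono[OF D(3,1) 2(1)])
      have "expectation (\<lambda>\<omega>. (Z \<omega> * \<phi> k \<omega>) * (w (b k) \<omega> $ i - w s \<omega> $ i)) = 0"
        by (rule expectation_past_mult_increment(2)[OF s less_imp_le[OF 2(2)] m int])
      moreover have "(\<lambda>\<omega>. (Z \<omega> * \<phi> k \<omega>) * (w (b k) \<omega> $ i - w s \<omega> $ i)) = (\<lambda>\<omega>. ?X k \<omega> - ?Y k \<omega>)"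
        using 2 by (simp add: fun_eq_iff algebra_simps)
      ultimately show ?thesis using iX[OF that] iY[OF that] by simp
    next
      case 3
      have m: "(\<lambda>\<omega>. Z \<omega> * \<phi> k \<omega>) \<in> borel_measurable (F (a k))"
        by (intro borel_measurable_times measurable_filtration_mono[OF Z(1) s] D(3) less_imp_le[OF 3])
      have "expectation (\<lambda>\<omega>. (Z \<omega> * \<phi> k \<omega>) * (w (b k) \<omega> $ i - w (a k) \<omega> $ i)) = 0"
        by (rule expectation_past_mult_increment(2)[OF D(1,2) m int])
      thus ?thesis using 3 by (simp add: mult.assoc)
    qed
  qed
  have "?L = (\<Sum>k<m. expectation (?X k))"
    unfolding elementary_integral_def sum_distrib_left
    using iX by (intro Bochner_Integration.integral_sum) simp
  also have "\<dots> = (\<Sum>k<m. expectation (?Y k))"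
    using eq by (intro sum.cong refl) simp
  also have "\<dots> = ?R"
    unfolding elementary_integral_def sum_distrib_left
    using iY by (intro Bochner_Integration.integral_sum[symmetric]) simp
  finally show ?thesis .
qed

text \<open>The integrand is a function on the product of time and probability space, and the
  interval of integration is encoded in it by an indicator function. All integrands then live in
  one Hilbert space, whatever their time interval.\<close>

definition ito_limit :: "'q \<Rightarrow> (real \<times> 'a \<Rightarrow> real) \<Rightarrow> ('a \<Rightarrow> real) \<Rightarrow> bool" where
  "ito_limit i f J \<longleftrightarrow> (\<exists>m a b \<phi>. (\<forall>n. elementary (m n) (a n) (b n) (\<phi> n)) \<and>
     L2_tendsto (lborel \<Otimes>\<^sub>M M) (\<lambda>n. elementary_process (m n) (a n) (b n) (\<phi> n)) f \<and>
     L2_tendsto M (\<lambda>n. elementary_integral i (m n) (a n) (b n) (\<phi> n)) J)"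

lemma ito_limit_square_integrable:
  assumes "ito_limit i f J"
  shows "square_integrable (lborel \<Otimes>\<^sub>M M) f" "square_integrable M J"
  using assms unfolding ito_limit_def L2_tendsto_def by blast+

lemma ito_isometry:
  assumes "ito_limit i f J" and "ito_limit j g J'"
  shows "expectation (\<lambda>\<omega>. J \<omega> * J' \<omega>) = K $ i $ j * (\<integral>z. f z * g z \<partial>(lborel \<Otimes>\<^sub>M M))"
proof -
  obtain m a b \<phi> where e: "\<And>n. elementary (m n) (a n) (b n) (\<phi> n)"
    and lim: "L2_tendsto (lborel \<Otimes>\<^sub>M M) (\<lambda>n. elementary_process (m n) (a n) (b n) (\<phi> n)) f"
      "L2_tendsto M (\<lambda>n. elementary_integral i (m n) (a n) (b n) (\<phi> n)) J"
    using assms(1) unfolding ito_limit_def by blast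
  obtain m' a' b' \<phi>' where e': "\<And>n. elementary (m' n) (a' n) (b' n) (\<phi>' n)"
    and lim': "L2_tendsto (lborel \<Otimes>\<^sub>M M) (\<lambda>n. elementary_process (m' n) (a' n) (b' n) (\<phi>' n)) g"
      "L2_tendsto M (\<lambda>n. elementary_integral j (m' n) (a' n) (b' n) (\<phi>' n)) J'"
    using assms(2) unfolding ito_limit_def by blast
  show ?thesis
  proof (rule LIMSEQ_unique)
    show "(\<lambda>n. expectation (\<lambda>\<omega>. elementary_integral i (m n) (a n) (b n) (\<phi> n) \<omega> *
        elementary_integral j (m' n) (a' n) (b' n) (\<phi>' n) \<omega>)) \<longlonglongrightarrow> expectation (\<lambda>\<omega>. J \<omega> * J' \<omega>)"
      by (rule L2_tendsto_inner[OF lim(2) lim'(2)])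
    show "(\<lambda>n. expectation (\<lambda>\<omega>. elementary_integral i (m n) (a n) (b n) (\<phi> n) \<omega> *
        elementary_integral j (m' n) (a' n) (b' n) (\<phi>' n) \<omega>))
        \<longlonglongrightarrow> K $ i $ j * (\<integral>z. f z * g z \<partial>(lborel \<Otimes>\<^sub>M M))"
      unfolding elementary_isometry[OF e e']
      by (rule tendsto_mult_left[OF L2_tendsto_inner[OF lim(1) lim'(1)]])
  qed
qed

text \<open>The restrictions to \<open>{..s}\<close> of the integrands that approximate \<open>f\<close> approximate the
  restriction of \<open>f\<close>, but \<open>J'\<close> may have been obtained from a different approximating sequence.
  By the isometry, the integrals of the two sequences differ by a null sequence in mean square,
  so both can be used to compute \<open>E[Z J']\<close>.\<close>

lemma expectation_past_mult_ito_limit: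
  assumes J: "ito_limit i f J" and J': "ito_limit i (\<lambda>z. indicator {..s} (fst z) * f z) J'"
    and s: "0 \<le> s" and Z: "Z \<in> borel_measurable (F s)" "square_integrable M Z"
  shows "expectation (\<lambda>\<omega>. Z \<omega> * J \<omega>) = expectation (\<lambda>\<omega>. Z \<omega> * J' \<omega>)"
proof -
  let ?Q = "lborel \<Otimes>\<^sub>M M"
  let ?f = "\<lambda>z. indicator {..s} (fst z) * f z"
  obtain m a b \<phi> where e: "\<And>n. elementary (m n) (a n) (b n) (\<phi> n)"
    and lim: "L2_tendsto ?Q (\<lambda>n. elementary_process (m n) (a n) (b n) (\<phi> n)) f"
      "L2_tendsto M (\<lambda>n. elementary_integral i (m n) (a n) (b n) (\<phi> n)) J"
    using J unfolding ito_limit_def by blast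
  obtain m' a' b' \<phi>' where e': "\<And>n. elementary (m' n) (a' n) (b' n) (\<phi>' n)"
    and lim': "L2_tendsto ?Q (\<lambda>n. elementary_process (m' n) (a' n) (b' n) (\<phi>' n)) ?f"
      "L2_tendsto M (\<lambda>n. elementary_integral i (m' n) (a' n) (b' n) (\<phi>' n)) J'"
    using J' unfolding ito_limit_def by blast
  define G where "G n = elementary_process (m' n) (a' n) (b' n) (\<phi>' n)" for n
  define IG where "IG n = elementary_integral i (m' n) (a' n) (b' n) (\<phi>' n)" for n
  define H where "H n = elementary_process (m n) (\<lambda>k. min (a n k) s) (\<lambda>k. min (b n k) s)
      (\<lambda>k \<omega>. if a n k \<le> s then \<phi> n k \<omega> else 0)" for n
  define IH where "IH n = elementary_integral i (m n) (\<lambda>k. min (a n k) s) (\<lambda>k. min (b n k) s)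
      (\<lambda>k \<omega>. if a n k \<le> s then \<phi> n k \<omega> else 0)" for n
  note t = elementary_truncate[OF e s]
  have sq: "square_integrable M (IG n)" "square_integrable M (IH n)" for n
    unfolding IG_def IH_def by (rule elementary_integral_square_integrable[OF e'] elementary_integral_square_integrable[OF t])+
  have limG: "L2_tendsto ?Q G ?f" using lim'(1) by (simp add: G_def[abs_def])
  have limH: "L2_tendsto ?Q H ?f"
    unfolding H_def[abs_def] elementary_process_truncate[abs_def]
    by (rule L2_tendsto_contraction_mult[OF lim(1)]) (auto simp: indicator_def)
  have "(\<lambda>n. expectation (\<lambda>\<omega>. (IH n \<omega> - IG n \<omega>)\<^sup>2)) \<longlonglongrightarrow> 0"
  proof -
    have "expectation (\<lambda>\<omega>. (IH n \<omega> - IG n \<omega>)\<^sup>2) = K $ i $ i * ((\<integral>z. H n z * H n z \<partial>?Q)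
        - 2 * (\<integral>z. H n z * G n z \<partial>?Q) + (\<integral>z. G n z * G n z \<partial>?Q))" for n
    proof -
      have "(IH n \<omega> - IG n \<omega>)\<^sup>2 = (IH n \<omega> * IH n \<omega> - 2 * (IH n \<omega> * IG n \<omega>)) + IG n \<omega> * IG n \<omega>" for \<omega>
        by (simp add: power2_eq_square algebra_simps)
      hence "expectation (\<lambda>\<omega>. (IH n \<omega> - IG n \<omega>)\<^sup>2) = (expectation (\<lambda>\<omega>. IH n \<omega> * IH n \<omega>)
          - 2 * expectation (\<lambda>\<omega>. IH n \<omega> * IG n \<omega>)) + expectation (\<lambda>\<omega>. IG n \<omega> * IG n \<omega>)"
        using integrable_mult_square_integrable[OF sq(2) sq(2), of n n] integrable_mult_square_integrable[OF sq(2) sq(1), of n n]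
          integrable_mult_square_integrable[OF sq(1) sq(1), of n n] by simp
      thus ?thesis
        unfolding IH_def IG_def H_def G_def elementary_isometry[OF t t] elementary_isometry[OF t e'] elementary_isometry[OF e' e']
        by (simp add: algebra_simps)
    qed
    moreover have "(\<lambda>n. K $ i $ i * ((\<integral>z. H n z * H n z \<partial>?Q)
        - 2 * (\<integral>z. H n z * G n z \<partial>?Q) + (\<integral>z. G n z * G n z \<partial>?Q))) \<longlonglongrightarrow>
        K $ i $ i * ((\<integral>z. ?f z * ?f z \<partial>?Q) - 2 * (\<integral>z. ?f z * ?f z \<partial>?Q) + (\<integral>z. ?f z * ?f z \<partial>?Q))"
      by (intro tendsto_intros L2_tendsto_inner limH limG)
    ultimately show ?thesis by simp
  qed
  hence sqrt0: "(\<lambda>n. sqrt (expectation (\<lambda>\<omega>. (IH n \<omega> - IG n \<omega>)\<^sup>2))) \<longlonglongrightarrow> 0"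
    using tendsto_real_sqrt[of _ 0] by fastforce
  have "(\<lambda>n. expectation (\<lambda>\<omega>. Z \<omega> * IH n \<omega>) - expectation (\<lambda>\<omega>. Z \<omega> * IG n \<omega>)) \<longlonglongrightarrow> 0"
  proof (rule Lim_null_comparison)
    show "(\<lambda>n. sqrt (expectation (\<lambda>\<omega>. (Z \<omega>)\<^sup>2)) * sqrt (expectation (\<lambda>\<omega>. (IH n \<omega> - IG n \<omega>)\<^sup>2))) \<longlonglongrightarrow> 0"
      using tendsto_mult_left[OF sqrt0] by simp
    have "expectation (\<lambda>\<omega>. Z \<omega> * IH n \<omega>) - expectation (\<lambda>\<omega>. Z \<omega> * IG n \<omega>) = expectation (\<lambda>\<omega>. Z \<omega> * (IH n \<omega> - IG n \<omega>))" for n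
      using integrable_mult_square_integrable[OF Z(2) sq(1), of n] integrable_mult_square_integrable[OF Z(2) sq(2), of n]
      by (simp add: right_diff_distrib)
    thus "\<forall>\<^sub>F n in sequentially. norm (expectation (\<lambda>\<omega>. Z \<omega> * IH n \<omega>) - expectation (\<lambda>\<omega>. Z \<omega> * IG n \<omega>)) \<le>
        sqrt (expectation (\<lambda>\<omega>. (Z \<omega>)\<^sup>2)) * sqrt (expectation (\<lambda>\<omega>. (IH n \<omega> - IG n \<omega>)\<^sup>2))"
      using Cauchy_Schwarz_lebesgue_integral[OF Z(2) square_integrable_diff[OF sq(2) sq(1)]] by simp
  qed
  moreover have constZ: "L2_tendsto M (\<lambda>_. Z) Z" using Z(2) by (simp add: L2_tendsto_def)
  have "(\<lambda>n. expectation (\<lambda>\<omega>. Z \<omega> * IH n \<omega>)) \<longlonglongrightarrow> expectation (\<lambda>\<omega>. Z \<omega> * J \<omega>)"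
    using L2_tendsto_inner[OF constZ lim(2)]
    unfolding IH_def expectation_past_mult_elementary_integral[OF e s Z] .
  moreover have "(\<lambda>n. expectation (\<lambda>\<omega>. Z \<omega> * IG n \<omega>)) \<longlonglongrightarrow> expectation (\<lambda>\<omega>. Z \<omega> * J' \<omega>)"
    using L2_tendsto_inner[OF constZ lim'(2)] unfolding IG_def .
  ultimately have "expectation (\<lambda>\<omega>. Z \<omega> * J \<omega>) - expectation (\<lambda>\<omega>. Z \<omega> * J' \<omega>) = 0"
    using LIMSEQ_unique[OF tendsto_diff] by blast
  thus ?thesis by simp
qed

end

section \<open>Progressively measurable integrands\<close>

context filtered_prob_space
begin

lemma progressive_section_measurable:
  assumes "(\<lambda>(s, \<omega>). f s \<omega>) \<in> borel_measurable (restrict_space borel {0..t} \<Otimes>\<^sub>M F t)" and "0 \<le> t"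
  shows "f t \<in> borel_measurable (F t)"
proof -
  have "t \<in> space (restrict_space borel {0..t})" using assms(2) by (simp add: space_restrict_space)
  from measurable_compose[OF measurable_Pair1'[OF this] assms(1)] show ?thesis by simp
qed

lemma progressive_jointly_measurable:
  fixes f :: "real \<Rightarrow> 'a \<Rightarrow> 'b::euclidean_space"
  assumes f: "(\<lambda>(s, \<omega>). f s \<omega>) \<in> borel_measurable (restrict_space borel {0..T} \<Otimes>\<^sub>M F T)" and T: "0 \<le> T"
  shows "(\<lambda>z. indicator {0..T} (fst z) *\<^sub>R f (fst z) (snd z)) \<in> borel_measurable (lborel \<Otimes>\<^sub>M M)"
proof -
  \<comment> \<open>clamping the time to \<open>[0, T]\<close> turns the restricted into a total function\<close>
  define c where "c s = max 0 (min T s)" for s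
  have c: "c \<in> borel \<rightarrow>\<^sub>M restrict_space borel {0..T}"
    using T by (intro measurable_restrict_space2) (auto simp: c_def[abs_def])
  have "(\<lambda>z. c (fst z)) \<in> lborel \<Otimes>\<^sub>M M \<rightarrow>\<^sub>M restrict_space borel {0..T}"
    using measurable_compose[OF measurable_fst, of c lborel] c by simp
  moreover have "snd \<in> lborel \<Otimes>\<^sub>M M \<rightarrow>\<^sub>M F T"
  proof (rule measurableI)
    fix z assume "z \<in> space (lborel \<Otimes>\<^sub>M M)"
    thus "snd z \<in> space (F T)" using T by (auto simp: space_pair_measure)
  next
    fix A assume "A \<in> sets (F T)"
    hence "A \<in> sets M" using filtration_subalgebra[OF T] by (auto simp: subalgebra_def)
    from measurable_sets[OF measurable_snd this, of lborel]
    show "snd -` A \<inter> space (lborel \<Otimes>\<^sub>M M) \<in> sets (lborel \<Otimes>\<^sub>M M)" .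
  qed
  ultimately have "(\<lambda>z. (c (fst z), snd z)) \<in> lborel \<Otimes>\<^sub>M M \<rightarrow>\<^sub>M restrict_space borel {0..T} \<Otimes>\<^sub>M F T"
    by (rule measurable_Pair)
  from measurable_compose[OF this f]
  have "(\<lambda>z. f (c (fst z)) (snd z)) \<in> borel_measurable (lborel \<Otimes>\<^sub>M M)" by simp
  hence "(\<lambda>z. indicator {0..T} (fst z) *\<^sub>R f (c (fst z)) (snd z)) \<in> borel_measurable (lborel \<Otimes>\<^sub>M M)"
    by (intro borel_measurable_scaleR) simp_all
  moreover have "indicator {0..T} (fst z) *\<^sub>R f (c (fst z)) (snd z) = indicator {0..T} (fst z) *\<^sub>R f (fst z) (snd z)" for z
    by (auto simp: indicator_def c_def)
  ultimately show ?thesis by simp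
qed

lemma nn_integral_time_first:
  assumes [measurable]: "g \<in> borel_measurable (lborel \<Otimes>\<^sub>M M)"
  shows "(\<integral>\<^sup>+\<omega>. (\<integral>\<^sup>+s. g (s, \<omega>) \<partial>lborel) \<partial>M) = (\<integral>\<^sup>+z. g z \<partial>(lborel \<Otimes>\<^sub>M M))"
proof -
  interpret path: pair_sigma_finite lborel M ..
  show ?thesis by (rule path.nn_integral_snd) fact
qed

lemma ito_integrand_square_integrable:
  fixes f :: "real \<Rightarrow> 'a \<Rightarrow> 'b::euclidean_space"
  assumes f: "ito_integrand M F T f" and T: "0 \<le> T"
  shows "square_integrable (lborel \<Otimes>\<^sub>M M) (\<lambda>z. indicator {0..T} (fst z) * (u \<bullet> f (fst z) (snd z)))"
proof -
  have m: "(\<lambda>z. indicator {0..T} (fst z) *\<^sub>R f (fst z) (snd z)) \<in> borel_measurable (lborel \<Otimes>\<^sub>M M)"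
    using f T by (intro progressive_jointly_measurable) (auto simp: ito_integrand_def)
  hence "(\<lambda>z. u \<bullet> (indicator {0..T} (fst z) *\<^sub>R f (fst z) (snd z))) \<in> borel_measurable (lborel \<Otimes>\<^sub>M M)"
    by (intro borel_measurable_inner) simp_all
  hence mu: "(\<lambda>z. indicator {0..T} (fst z) * (u \<bullet> f (fst z) (snd z))) \<in> borel_measurable (lborel \<Otimes>\<^sub>M M)" by simp
  have "(\<integral>\<^sup>+z. ennreal ((norm (indicator {0..T} (fst z) *\<^sub>R f (fst z) (snd z)))\<^sup>2) \<partial>(lborel \<Otimes>\<^sub>M M)) =
     (\<integral>\<^sup>+\<omega>. (\<integral>\<^sup>+s\<in>{0..T}. ennreal ((norm (f s \<omega>))\<^sup>2) \<partial>lborel) \<partial>M)"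
    by (subst nn_integral_time_first[symmetric], intro measurable_compose[OF _ measurable_ennreal] borel_measurable_power measurable_compose[OF _ borel_measurable_norm] m)
      (auto intro!: nn_integral_cong simp: indicator_def)
  also have "\<dots> < \<infinity>" using f by (simp add: ito_integrand_def)
  finally have fin: "(\<integral>\<^sup>+z. ennreal ((norm (indicator {0..T} (fst z) *\<^sub>R f (fst z) (snd z)))\<^sup>2) \<partial>(lborel \<Otimes>\<^sub>M M)) < \<infinity>" .
  have int: "integrable (lborel \<Otimes>\<^sub>M M) (\<lambda>z. (norm (indicator {0..T} (fst z) *\<^sub>R f (fst z) (snd z)))\<^sup>2)"
  proof (rule integrableI_nonneg)
    show "(\<lambda>z. (norm (indicator {0..T} (fst z) *\<^sub>R f (fst z) (snd z)))\<^sup>2) \<in> borel_measurable (lborel \<Otimes>\<^sub>M M)"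
      by (intro borel_measurable_power measurable_compose[OF _ borel_measurable_norm] m)
  qed (use fin in simp_all)
  have "integrable (lborel \<Otimes>\<^sub>M M) (\<lambda>z. (indicator {0..T} (fst z) * (u \<bullet> f (fst z) (snd z)))\<^sup>2)"
  proof (rule Bochner_Integration.integrable_bound)
    show "integrable (lborel \<Otimes>\<^sub>M M) (\<lambda>z. (norm u)\<^sup>2 * (norm (indicator {0..T} (fst z) *\<^sub>R f (fst z) (snd z)))\<^sup>2)"
      using int by simp
    show "(\<lambda>z. (indicator {0..T} (fst z) * (u \<bullet> f (fst z) (snd z)))\<^sup>2) \<in> borel_measurable (lborel \<Otimes>\<^sub>M M)"
      by (intro borel_measurable_power mu)
    have "(u \<bullet> y)\<^sup>2 \<le> (norm u)\<^sup>2 * (norm y)\<^sup>2" for y :: 'b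
      using Cauchy_Schwarz_ineq[of u y] by (simp add: power2_norm_eq_inner)
    thus "AE z in lborel \<Otimes>\<^sub>M M. norm ((indicator {0..T} (fst z) * (u \<bullet> f (fst z) (snd z)))\<^sup>2)
        \<le> norm ((norm u)\<^sup>2 * (norm (indicator {0..T} (fst z) *\<^sub>R f (fst z) (snd z)))\<^sup>2)"
      by (intro AE_I2) (auto simp: indicator_def)
  qed
  thus ?thesis using mu by (simp add: square_integrable_def)
qed

end

context wiener_process
begin

text \<open>Scalar products with a fixed vector turn an approximation by vector valued simple integrands
  into one by scalar elementary integrands, since \<open>(u \<bullet> y)\<^sup>2 \<le> \<parallel>u\<parallel>\<^sup>2 \<parallel>y\<parallel>\<^sup>2\<close>.\<close>

lemma has_ito_integral_imp_ito_limit: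
  fixes f :: "real \<Rightarrow> 'a \<Rightarrow> 'b::euclidean_space"
  assumes ito: "has_ito_integral M F (\<lambda>s \<omega>. w s \<omega> $ i) T f J" and T: "0 \<le> T"
  shows "ito_limit i (\<lambda>z. indicator {0..T} (fst z) * (u \<bullet> f (fst z) (snd z))) (\<lambda>\<omega>. u \<bullet> J \<omega>)"
proof -
  let ?Q = "lborel \<Otimes>\<^sub>M M"
  obtain m \<tau> \<phi> where simple: "\<And>n. simple_integrand M F T (m n) (\<tau> n) (\<phi> n)"
    and limf: "(\<lambda>n. \<integral>\<^sup>+\<omega>. (\<integral>\<^sup>+s\<in>{0..T}.
              ennreal ((norm (f s \<omega> - simple_process (m n) (\<tau> n) (\<phi> n) s \<omega>))\<^sup>2) \<partial>lborel) \<partial>M) \<longlonglongrightarrow> 0"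
    and limJ: "(\<lambda>n. \<integral>\<^sup>+\<omega>. ennreal ((norm (J \<omega> - simple_ito_integral (\<lambda>s \<omega>. w s \<omega> $ i) (m n) (\<tau> n) (\<phi> n) \<omega>))\<^sup>2) \<partial>M) \<longlonglongrightarrow> 0"
    using ito unfolding has_ito_integral_def by blast
  have f: "ito_integrand M F T f" and J: "J \<in> borel_measurable M"
    using ito by (auto simp: has_ito_integral_def)
  define H where "H n = elementary_process (m n) (\<tau> n) (\<lambda>k. \<tau> n (Suc k)) (\<lambda>k \<omega>. u \<bullet> \<phi> n k \<omega>)" for n
  define I where "I n = elementary_integral i (m n) (\<tau> n) (\<lambda>k. \<tau> n (Suc k)) (\<lambda>k \<omega>. u \<bullet> \<phi> n k \<omega>)" for n
  have \<tau>: "0 \<le> \<tau> n k \<and> \<tau> n k \<le> \<tau> n (Suc k) \<and> \<tau> n (Suc k) \<le> T" if "k < m n" for n k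
  proof -
    have mono: "\<tau> n j \<le> \<tau> n l" if "j \<le> l" "l \<le> m n" for j l
      using that
    proof (induction l rule: dec_induct)
      case (step l)
      have "\<tau> n l < \<tau> n (Suc l)" using simple[of n] step by (simp add: simple_integrand_def)
      thus ?case using step by simp
    qed simp
    show ?thesis using simple[of n] mono[of 0 k] mono[of "Suc k" "m n"] mono[of k "Suc k"] that
      unfolding simple_integrand_def by auto
  qed
  have elem: "elementary (m n) (\<tau> n) (\<lambda>k. \<tau> n (Suc k)) (\<lambda>k \<omega>. u \<bullet> \<phi> n k \<omega>)" for n
    unfolding elementary_def
  proof (intro allI impI conjI)
    fix k assume k: "k < m n"
    show "0 \<le> \<tau> n k" "\<tau> n k \<le> \<tau> n (Suc k)" using \<tau>[OF k] by auto
    show "(\<lambda>\<omega>. u \<bullet> \<phi> n k \<omega>) \<in> borel_measurable (F (\<tau> n k))"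
      using simple[of n] k by (intro borel_measurable_inner) (auto simp: simple_integrand_def)
    have "bounded (\<phi> n k ` space M)" using simple[of n] k by (auto simp: simple_integrand_def)
    from bounded_linear_image[OF this bounded_linear_inner_right[of u]]
    show "bounded ((\<lambda>\<omega>. u \<bullet> \<phi> n k \<omega>) ` space M)" by (simp add: image_image)
  qed
  have H: "H n z = indicator {0..T} (fst z) * (u \<bullet> simple_process (m n) (\<tau> n) (\<phi> n) (fst z) (snd z))" for n z
    unfolding H_def elementary_process_def simple_process_def inner_sum_right sum_distrib_left
  proof (intro sum.cong refl)
    fix k assume "k \<in> {..<m n}"
    with \<tau>[of k n] have "{\<tau> n k<..\<tau> n (Suc k)} \<subseteq> {0..T}" by auto
    thus "indicator {\<tau> n k<..\<tau> n (Suc k)} (fst z) * (u \<bullet> \<phi> n k (snd z)) =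
        indicator {0..T} (fst z) * (u \<bullet> indicator {\<tau> n k<..\<tau> n (Suc k)} (fst z) *\<^sub>R \<phi> n k (snd z))"
      by (auto simp: indicator_def)
  qed
  have I: "I n \<omega> = u \<bullet> simple_ito_integral (\<lambda>s \<omega>. w s \<omega> $ i) (m n) (\<tau> n) (\<phi> n) \<omega>" for n \<omega>
    by (simp add: I_def elementary_integral_def simple_ito_integral_def inner_sum_right mult.commute)
  have sq: "ennreal ((u \<bullet> y - u \<bullet> z)\<^sup>2) \<le> ennreal ((norm u)\<^sup>2) * ennreal ((norm (y - z))\<^sup>2)" for y z :: 'b
  proof -
    have "(u \<bullet> (y - z))\<^sup>2 \<le> (norm u)\<^sup>2 * (norm (y - z))\<^sup>2"
      using Cauchy_Schwarz_ineq[of u "y - z"] by (simp only: power2_norm_eq_inner)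
    thus ?thesis by (simp add: inner_diff_right ennreal_mult[symmetric] ennreal_leI)
  qed
  have m\<phi>: "\<phi> n k \<in> borel_measurable M" if "k < m n" for n k
    using measurable_filtration[of "\<phi> n k" "\<tau> n k"] \<tau>[OF that] simple[of n] that by (simp add: simple_integrand_def)
  have mS: "(\<lambda>z. simple_process (m n) (\<tau> n) (\<phi> n) (fst z) (snd z)) \<in> borel_measurable ?Q" for n
    unfolding simple_process_def
    by (intro borel_measurable_sum borel_measurable_scaleR measurable_compose[OF measurable_snd m\<phi>]) simp_all
  have mSJ: "simple_ito_integral (\<lambda>s \<omega>. w s \<omega> $ i) (m n) (\<tau> n) (\<phi> n) \<in> borel_measurable M" for n
    unfolding simple_ito_integral_def
  proof (intro borel_measurable_sum borel_measurable_scaleR)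
    fix k assume k: "k \<in> {..<m n}"
    show "(\<lambda>\<omega>. w (\<tau> n (Suc k)) \<omega> $ i - w (\<tau> n k) \<omega> $ i) \<in> borel_measurable M"
      using \<tau>[of k n] k square_integrableD(1)[OF wiener_increment_moments(1)] by simp
    show "\<phi> n k \<in> borel_measurable M" using m\<phi> k by simp
  qed
  have mf: "(\<lambda>z. indicator {0..T} (fst z) *\<^sub>R f (fst z) (snd z)) \<in> borel_measurable ?Q"
    using f T by (intro progressive_jointly_measurable) (auto simp: ito_integrand_def)
  have limH: "L2_tendsto ?Q H (\<lambda>z. indicator {0..T} (fst z) * (u \<bullet> f (fst z) (snd z)))"
  proof (rule L2_tendstoI_nn_integral)
    show sqH: "square_integrable ?Q (H n)" for n
      unfolding H_def by (rule elementary_process_square_integrable[OF elem])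
    show "(\<lambda>z. indicator {0..T} (fst z) * (u \<bullet> f (fst z) (snd z))) \<in> borel_measurable ?Q"
      using ito_integrand_square_integrable[OF f T] by (rule square_integrableD)
    show "(\<lambda>n. \<integral>\<^sup>+z. ennreal ((indicator {0..T} (fst z) * (u \<bullet> f (fst z) (snd z)) - H n z)\<^sup>2) \<partial>?Q) \<longlonglongrightarrow> 0"
    proof (rule tendsto_sandwich[OF _ _ tendsto_const])
      show "(\<lambda>n. ennreal ((norm u)\<^sup>2) * (\<integral>\<^sup>+\<omega>. (\<integral>\<^sup>+s\<in>{0..T}.
              ennreal ((norm (f s \<omega> - simple_process (m n) (\<tau> n) (\<phi> n) s \<omega>))\<^sup>2) \<partial>lborel) \<partial>M)) \<longlonglongrightarrow> 0"
        using ennreal_tendsto_cmult[OF _ limf, of "ennreal ((norm u)\<^sup>2)"] by simp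
      show "\<forall>\<^sub>F n in sequentially. (\<integral>\<^sup>+z. ennreal ((indicator {0..T} (fst z) * (u \<bullet> f (fst z) (snd z)) - H n z)\<^sup>2) \<partial>?Q)
          \<le> ennreal ((norm u)\<^sup>2) * (\<integral>\<^sup>+\<omega>. (\<integral>\<^sup>+s\<in>{0..T}.
              ennreal ((norm (f s \<omega> - simple_process (m n) (\<tau> n) (\<phi> n) s \<omega>))\<^sup>2) \<partial>lborel) \<partial>M)"
      proof (intro always_eventually allI)
        fix n
        let ?S = "simple_process (m n) (\<tau> n) (\<phi> n)"
        show "(\<integral>\<^sup>+z. ennreal ((indicator {0..T} (fst z) * (u \<bullet> f (fst z) (snd z)) - H n z)\<^sup>2) \<partial>?Q)
          \<le> ennreal ((norm u)\<^sup>2) * (\<integral>\<^sup>+\<omega>. (\<integral>\<^sup>+s\<in>{0..T}. ennreal ((norm (f s \<omega> - ?S s \<omega>))\<^sup>2) \<partial>lborel) \<partial>M)"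
        proof -
          let ?D = "\<lambda>z. indicator {0..T} (fst z) *\<^sub>R f (fst z) (snd z) - indicator {0..T} (fst z) *\<^sub>R ?S (fst z) (snd z)"
          have mIS: "(\<lambda>z. indicator {0..T} (fst z) *\<^sub>R ?S (fst z) (snd z)) \<in> borel_measurable ?Q"
            by (intro borel_measurable_scaleR mS) simp
          have mD: "(\<lambda>z. ennreal ((norm (?D z))\<^sup>2)) \<in> borel_measurable ?Q"
            by (intro measurable_compose[OF _ measurable_ennreal] borel_measurable_power
                measurable_compose[OF _ borel_measurable_norm] borel_measurable_diff[OF mf mIS])
          have "(\<integral>\<^sup>+z. ennreal ((indicator {0..T} (fst z) * (u \<bullet> f (fst z) (snd z)) - H n z)\<^sup>2) \<partial>?Q)
              \<le> (\<integral>\<^sup>+z. ennreal ((norm u)\<^sup>2) * ennreal ((norm (?D z))\<^sup>2) \<partial>?Q)"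
            using sq by (intro nn_integral_mono) (simp add: H inner_scaleR_right[symmetric] del: inner_scaleR_right)
          also have "\<dots> = ennreal ((norm u)\<^sup>2) * (\<integral>\<^sup>+z. ennreal ((norm (?D z))\<^sup>2) \<partial>?Q)"
            by (rule nn_integral_cmult[OF mD])
          also have "(\<integral>\<^sup>+z. ennreal ((norm (?D z))\<^sup>2) \<partial>?Q)
              = (\<integral>\<^sup>+\<omega>. (\<integral>\<^sup>+s\<in>{0..T}. ennreal ((norm (f s \<omega> - ?S s \<omega>))\<^sup>2) \<partial>lborel) \<partial>M)"
            unfolding nn_integral_time_first[OF mD, symmetric]
            by (auto intro!: nn_integral_cong simp: indicator_def)
          finally show ?thesis .
        qed
      qed
    qed simp
  qed
  have limI: "L2_tendsto M I (\<lambda>\<omega>. u \<bullet> J \<omega>)"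
  proof (rule L2_tendstoI_nn_integral)
    show "square_integrable M (I n)" for n
      unfolding I_def by (rule elementary_integral_square_integrable[OF elem])
    show "(\<lambda>\<omega>. u \<bullet> J \<omega>) \<in> borel_measurable M" using J by (intro borel_measurable_inner) simp_all
    show "(\<lambda>n. \<integral>\<^sup>+\<omega>. ennreal ((u \<bullet> J \<omega> - I n \<omega>)\<^sup>2) \<partial>M) \<longlonglongrightarrow> 0"
    proof (rule tendsto_sandwich[OF _ _ tendsto_const])
      show "(\<lambda>n. ennreal ((norm u)\<^sup>2) * (\<integral>\<^sup>+\<omega>. ennreal ((norm (J \<omega> - simple_ito_integral (\<lambda>s \<omega>. w s \<omega> $ i) (m n) (\<tau> n) (\<phi> n) \<omega>))\<^sup>2) \<partial>M)) \<longlonglongrightarrow> 0"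
        using ennreal_tendsto_cmult[OF _ limJ, of "ennreal ((norm u)\<^sup>2)"] by simp
      show "\<forall>\<^sub>F n in sequentially. (\<integral>\<^sup>+\<omega>. ennreal ((u \<bullet> J \<omega> - I n \<omega>)\<^sup>2) \<partial>M)
          \<le> ennreal ((norm u)\<^sup>2) * (\<integral>\<^sup>+\<omega>. ennreal ((norm (J \<omega> - simple_ito_integral (\<lambda>s \<omega>. w s \<omega> $ i) (m n) (\<tau> n) (\<phi> n) \<omega>))\<^sup>2) \<partial>M)"
      proof (intro always_eventually allI)
        fix n
        let ?S = "simple_ito_integral (\<lambda>s \<omega>. w s \<omega> $ i) (m n) (\<tau> n) (\<phi> n)"
        have "(\<integral>\<^sup>+\<omega>. ennreal ((u \<bullet> J \<omega> - I n \<omega>)\<^sup>2) \<partial>M) \<le> (\<integral>\<^sup>+\<omega>. ennreal ((norm u)\<^sup>2) * ennreal ((norm (J \<omega> - ?S \<omega>))\<^sup>2) \<partial>M)"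
          unfolding I by (intro nn_integral_mono sq)
        also have "\<dots> = ennreal ((norm u)\<^sup>2) * (\<integral>\<^sup>+\<omega>. ennreal ((norm (J \<omega> - ?S \<omega>))\<^sup>2) \<partial>M)"
          by (intro nn_integral_cmult measurable_compose[OF _ measurable_ennreal] borel_measurable_power
              measurable_compose[OF _ borel_measurable_norm] borel_measurable_diff J mSJ)
        finally show "(\<integral>\<^sup>+\<omega>. ennreal ((u \<bullet> J \<omega> - I n \<omega>)\<^sup>2) \<partial>M)
          \<le> ennreal ((norm u)\<^sup>2) * (\<integral>\<^sup>+\<omega>. ennreal ((norm (J \<omega> - ?S \<omega>))\<^sup>2) \<partial>M)" .
      qed
    qed simp
  qed
  show ?thesis
    unfolding ito_limit_def
    by (rule exI[of _ m], rule exI[of _ \<tau>], rule exI[of _ "\<lambda>n k. \<tau> n (Suc k)"],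
        rule exI[of _ "\<lambda>n k \<omega>. u \<bullet> \<phi> n k \<omega>"])
       (use elem limH limI in \<open>auto simp: H_def[abs_def] I_def[abs_def]\<close>)
qed

end

section \<open>Second moments of a drift plus a martingale\<close>

text \<open>The derivative of \<open>(c + \<integral>\<^sub>0\<^sup>s \<alpha>)\<^sup>2\<close> is \<open>2 \<alpha>(s) (c + \<integral>\<^sub>0\<^sup>s \<alpha>)\<close>.\<close>

lemma square_of_absolutely_continuous:
  fixes \<alpha> :: "real \<Rightarrow> real"
  assumes \<alpha>: "continuous_on {0..t} \<alpha>" and t: "0 \<le> t"
  shows "(c + (LINT r:{0..t}|lborel. \<alpha> r))\<^sup>2 =
    c\<^sup>2 + 2 * (LINT s:{0..t}|lborel. \<alpha> s * (c + (LINT r:{0..s}|lborel. \<alpha> r)))"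
proof -
  define a where "a s = c + integral {0..s} \<alpha>" for s
  have a: "c + (LINT r:{0..s}|lborel. \<alpha> r) = a s" if "s \<in> {0..t}" for s
  proof -
    have "continuous_on {0..s} \<alpha>" using \<alpha> that by (auto intro: continuous_on_subset)
    from set_borel_integral_eq_integral(2)[OF borel_integrable_atLeastAtMost'[OF this]]
    show ?thesis by (simp add: a_def)
  qed
  have da: "(a has_vector_derivative \<alpha> s) (at s within {0..t})" if "s \<in> {0..t}" for s
    unfolding a_def using integral_has_vector_derivative[OF \<alpha> that]
    by (auto intro!: derivative_eq_intros)
  have "((\<lambda>s. (a s)\<^sup>2) has_vector_derivative 2 * (\<alpha> s * a s)) (at s within {0..t})" if "s \<in> {0..t}" for s
    using da[OF that] unfolding has_real_derivative_iff_has_vector_derivative[symmetric]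
    by (auto intro!: derivative_eq_intros)
  from fundamental_theorem_of_calculus[OF t this]
  have hk: "((\<lambda>s. 2 * (\<alpha> s * a s)) has_integral (a t)\<^sup>2 - (a 0)\<^sup>2) {0..t}" by simp
  have "continuous_on {0..t} a"
    using da has_vector_derivative_continuous continuous_on_eq_continuous_within by blast
  hence cont: "continuous_on {0..t} (\<lambda>s. \<alpha> s * a s)" using \<alpha> by (intro continuous_on_mult)
  have "(LINT s:{0..t}|lborel. \<alpha> s * (c + (LINT r:{0..s}|lborel. \<alpha> r))) = (LINT s:{0..t}|lborel. \<alpha> s * a s)"
    using a by (intro set_lebesgue_integral_cong) auto
  also have "\<dots> = integral {0..t} (\<lambda>s. \<alpha> s * a s)"
    using set_borel_integral_eq_integral(2)[OF borel_integrable_atLeastAtMost'[OF cont]] .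
  finally have "2 * (LINT s:{0..t}|lborel. \<alpha> s * (c + (LINT r:{0..s}|lborel. \<alpha> r))) = (a t)\<^sup>2 - (a 0)\<^sup>2"
    using integral_unique[OF hk] by simp
  thus ?thesis using a[of t] t by (simp add: a_def)
qed

context prob_space
begin

interpretation path: pair_sigma_finite lborel M ..

text \<open>Write \<open>a(s) = \<integral>\<^sub>0\<^sup>s \<alpha>\<close>, so that \<open>m = \<xi> - c - a\<close>. By Fubini and the martingale property,
  \<open>E[a(t) m(t)] = \<integral>\<^sub>0\<^sup>t E[\<alpha>(s) m(s)] ds = \<integral>\<^sub>0\<^sup>t E[\<alpha>(s) \<xi>(s)] ds - \<integral>\<^sub>0\<^sup>t E[\<alpha>(s) (c + a(s))] ds\<close>.
  Twice the last integral is what \<open>E[(c + a(t))\<^sup>2]\<close> contributes besides \<open>c\<^sup>2\<close>, so that the two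
  cancel in \<open>E[\<xi>(t)\<^sup>2] = E[(c + a(t))\<^sup>2] + 2 E[a(t) m(t)] + E[m(t)\<^sup>2]\<close>.\<close>

lemma second_moment_drift_plus_martingale:
  fixes \<xi> \<alpha> m :: "real \<Rightarrow> 'a \<Rightarrow> real"
  assumes t: "0 \<le> t"
    and sq_\<alpha>: "square_integrable (lborel \<Otimes>\<^sub>M M) (\<lambda>z. indicator {0..t} (fst z) * \<alpha> (fst z) (snd z))"
    and sq_\<xi>: "square_integrable (lborel \<Otimes>\<^sub>M M) (\<lambda>z. indicator {0..t} (fst z) * \<xi> (fst z) (snd z))"
    and sq_m: "\<And>s. s \<in> {0..t} \<Longrightarrow> square_integrable M (m s)"
    and meas: "\<And>s. s \<in> {0..t} \<Longrightarrow> \<xi> s \<in> borel_measurable M"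
    and \<xi>: "\<And>s. s \<in> {0..t} \<Longrightarrow> AE \<omega> in M. \<xi> s \<omega> = c + (LINT r:{0..s}|lborel. \<alpha> r \<omega>) + m s \<omega>"
    and cont: "AE \<omega> in M. continuous_on {0..t} (\<lambda>s. \<alpha> s \<omega>)"
    and mart: "\<And>s. s \<in> {0..t} \<Longrightarrow> square_integrable M (\<alpha> s) \<Longrightarrow>
      expectation (\<lambda>\<omega>. \<alpha> s \<omega> * m t \<omega>) = expectation (\<lambda>\<omega>. \<alpha> s \<omega> * m s \<omega>)"
    and m_mean: "expectation (m t) = 0"
  shows "square_integrable M (\<xi> t)"
    and "expectation (\<lambda>\<omega>. (\<xi> t \<omega>)\<^sup>2) = c\<^sup>2 + 2 * (\<integral>z. indicator {0..t} (fst z) * (\<alpha> (fst z) (snd z) * \<xi> (fst z) (snd z)) \<partial>(lborel \<Otimes>\<^sub>M M))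
      + expectation (\<lambda>\<omega>. (m t \<omega>)\<^sup>2)"
proof -
  let ?Q = "(lborel :: real measure) \<Otimes>\<^sub>M M"
  define \<alpha>' where "\<alpha>' z = indicator {0..t} (fst z) * \<alpha> (fst z) (snd z)" for z
  define \<xi>' where "\<xi>' z = indicator {0..t} (fst z) * \<xi> (fst z) (snd z)" for z
  define a where "a s \<omega> = (\<integral>r. indicator {0..s} r * \<alpha>' (r, \<omega>) \<partial>lborel)" for s \<omega>
  define a' where "a' z = indicator {0..t} (fst z) * a (fst z) (snd z)" for z
  define B where "B \<omega> = (\<integral>r. (\<alpha>' (r, \<omega>))\<^sup>2 \<partial>lborel)" for \<omega>
  have sa: "square_integrable ?Q \<alpha>'" and sx: "square_integrable ?Q \<xi>'"
    using sq_\<alpha> sq_\<xi> by (simp_all add: \<alpha>'_def[abs_def] \<xi>'_def[abs_def])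
  note [measurable] = square_integrableD(1)[OF sa] square_integrableD(1)[OF sx]
  have a_eq: "a s \<omega> = (LINT r:{0..s}|lborel. \<alpha> r \<omega>)" if "s \<in> {0..t}" for s \<omega>
    unfolding a_def set_lebesgue_integral_def \<alpha>'_def using that
    by (intro Bochner_Integration.integral_cong) (auto simp: indicator_def)
  have a_meas: "(\<lambda>z. a (fst z) (snd z)) \<in> borel_measurable ?Q"
    unfolding a_def
  proof (rule lborel.borel_measurable_lebesgue_integral, unfold case_prod_beta')
    have [measurable]: "Measurable.pred (?Q \<Otimes>\<^sub>M (lborel :: real measure)) (\<lambda>z. snd z \<in> {0..fst (fst z)})"
    proof -
      have [measurable]: "(\<lambda>z. snd z) \<in> borel_measurable (?Q \<Otimes>\<^sub>M lborel)"
        "(\<lambda>z. fst (fst z)) \<in> borel_measurable (?Q \<Otimes>\<^sub>M lborel)"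
        using measurable_snd[of ?Q lborel] measurable_compose[OF measurable_fst measurable_fst, of lborel M lborel] by simp_all
      have "{z \<in> space (?Q \<Otimes>\<^sub>M lborel). (0::real) \<le> snd z \<and> snd z \<le> fst (fst z)} \<in> sets (?Q \<Otimes>\<^sub>M lborel)"
        by (intro sets.sets_Collect_conj borel_measurable_le) simp_all
      thus ?thesis by (simp add: pred_def)
    qed
    have "(\<lambda>z. if snd z \<in> {0..fst (fst z)} then \<alpha>' (snd z, snd (fst z)) else 0) \<in> borel_measurable (?Q \<Otimes>\<^sub>M lborel)"
      by measurable
    thus "(\<lambda>z. indicator {0..fst (fst z)} (snd z) * \<alpha>' (snd z, snd (fst z))) \<in> borel_measurable (?Q \<Otimes>\<^sub>M lborel)"
      by (rule measurable_cong[THEN iffD1, rotated]) (auto simp: indicator_def)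
  qed
  have a't_meas: "a s \<in> borel_measurable M" for s
    using measurable_compose[OF measurable_Pair1'[of s lborel M] a_meas] by simp
  \<comment> \<open>by Cauchy-Schwarz in time, \<open>a\<^sup>2 \<le> t B\<close>; this makes \<open>a\<close> square integrable on the product space\<close>
  have "integrable (lborel \<Otimes>\<^sub>M M) (\<lambda>(r, \<omega>). (\<alpha>' (r, \<omega>))\<^sup>2)"
    using square_integrableD(2)[OF sa] by (simp add: case_prod_beta')
  note B = path.AE_integrable_snd[OF this] path.integrable_snd[OF this]
  have B_int: "integrable M B" using B(2) by (simp add: B_def[abs_def])
  have a_le: "AE \<omega> in M. \<forall>s\<in>{0..t}. (a s \<omega>)\<^sup>2 \<le> t * B \<omega>"
    using B(1) AE_space
  proof eventually_elim
    case (elim \<omega>)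
    have s\<alpha>: "square_integrable lborel (\<lambda>r. \<alpha>' (r, \<omega>))"
      unfolding square_integrable_def
      using elim(1) measurable_compose[OF measurable_Pair2'[OF elim(2)] square_integrableD(1)[OF sa]] by simp
    show ?case
    proof
      fix s assume s: "s \<in> {0..t}"
      have si: "square_integrable lborel (indicator {0..s} :: real \<Rightarrow> real)"
        using s by (auto simp: square_integrable_def power2_eq_square indicator_inter_arith[symmetric]
            intro!: integrable_real_indicator)
      have "\<bar>a s \<omega>\<bar> \<le> sqrt (\<integral>r. (indicator {0..s} r)\<^sup>2 \<partial>lborel) * sqrt (B \<omega>)"
        unfolding a_def B_def by (rule Cauchy_Schwarz_lebesgue_integral[OF si s\<alpha>])
      also have "(\<integral>r. (indicator {0..s} r)\<^sup>2 \<partial>lborel) = s"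
        using s by (simp add: power2_eq_square indicator_inter_arith[symmetric])
      finally have "\<bar>a s \<omega>\<bar>\<^sup>2 \<le> (sqrt s * sqrt (B \<omega>))\<^sup>2" by (rule power_mono) simp
      also have "\<dots> = s * B \<omega>" using s by (simp add: power_mult_distrib B_def)
      also have "\<dots> \<le> t * B \<omega>" using s by (intro mult_right_mono) (auto simp: B_def)
      finally show "(a s \<omega>)\<^sup>2 \<le> t * B \<omega>" by simp
    qed
  qed
  have sat: "square_integrable M (a t)"
    unfolding square_integrable_def
  proof
    show "integrable M (\<lambda>\<omega>. (a t \<omega>)\<^sup>2)"
    proof (rule Bochner_Integration.integrable_bound)
      show "integrable M (\<lambda>\<omega>. t * B \<omega>)" using B_int by simp
      show "(\<lambda>\<omega>. (a t \<omega>)\<^sup>2) \<in> borel_measurable M" using a't_meas by (rule borel_measurable_power)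
      show "AE \<omega> in M. norm ((a t \<omega>)\<^sup>2) \<le> norm (t * B \<omega>)"
        using a_le by eventually_elim (use t in \<open>auto simp: abs_of_nonneg B_def\<close>)
    qed
  qed (rule a't_meas)
  have sI: "square_integrable ?Q (\<lambda>z. indicator {0..t} (fst z) * \<psi> (snd z))" if "square_integrable M \<psi>" for \<psi>
    unfolding square_integrable_def
  proof
    show "(\<lambda>z. indicator {0..t} (fst z) * \<psi> (snd z)) \<in> borel_measurable ?Q"
      using measurable_compose[OF measurable_snd square_integrableD(1)[OF that], of lborel]
      by (intro borel_measurable_times) simp_all
    have "(indicator {0..t} (fst z) * \<psi> (snd z))\<^sup>2 = indicator {0..t} (fst z) * (\<psi> (snd z))\<^sup>2" for z :: "real \<times> 'a"
      by (auto simp: indicator_def)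
    thus "integrable ?Q (\<lambda>z. (indicator {0..t} (fst z) * \<psi> (snd z))\<^sup>2)"
      using integral_indicator_times(1)[OF square_integrableD(2)[OF that], of "{0..t}"] t by simp
  qed
  have a'_meas: "a' \<in> borel_measurable ?Q"
    unfolding a'_def[abs_def] by (intro borel_measurable_times a_meas) simp
  have sa': "square_integrable ?Q a'"
    unfolding square_integrable_def
  proof
    show "integrable ?Q (\<lambda>z. (a' z)\<^sup>2)"
    proof (rule Bochner_Integration.integrable_bound)
      show iB: "integrable ?Q (\<lambda>z. indicator {0..t} (fst z) * (t * B (snd z)))"
        using B_int t by (intro integral_indicator_times) simp_all
      show "(\<lambda>z. (a' z)\<^sup>2) \<in> borel_measurable ?Q" using a'_meas by (rule borel_measurable_power)
      have "AE z in ?Q. (a' z)\<^sup>2 \<le> indicator {0..t} (fst z) * (t * B (snd z))"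
      proof (rule path.AE_pair_measure)
        show "{z \<in> space ?Q. (a' z)\<^sup>2 \<le> indicator {0..t} (fst z) * (t * B (snd z))} \<in> sets ?Q"
          by (intro borel_measurable_le borel_measurable_power a'_meas borel_measurable_integrable[OF iB])
        show "AE s in lborel. AE \<omega> in M. (a' (s, \<omega>))\<^sup>2 \<le> indicator {0..t} (fst (s, \<omega>)) * (t * B (snd (s, \<omega>)))"
        proof (rule AE_I2)
          fix s :: real
          show "AE \<omega> in M. (a' (s, \<omega>))\<^sup>2 \<le> indicator {0..t} (fst (s, \<omega>)) * (t * B (snd (s, \<omega>)))"
            using a_le by eventually_elim (auto simp: a'_def indicator_def)
        qed
      qed
      thus "AE z in ?Q. norm ((a' z)\<^sup>2) \<le> norm (indicator {0..t} (fst z) * (t * B (snd z)))"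
        by eventually_elim simp
    qed
  qed (rule a'_meas)
  have sI1: "square_integrable ?Q (\<lambda>z. indicator {0..t} (fst z) * c)"
    using sI[of "\<lambda>_. c"] by (simp add: square_integrable_def)
  note int = integrable_mult_square_integrable
  have tt: "t \<in> {0..t}" using t by simp
  have \<xi>t: "AE \<omega> in M. (c + a t \<omega>) + m t \<omega> = \<xi> t \<omega>"
    using \<xi>[OF tt] by eventually_elim (simp add: a_eq[OF tt])
  have sc: "square_integrable M (\<lambda>\<omega>. c + a t \<omega>)"
    using sat by (intro square_integrable_add) (simp_all add: square_integrable_def)
  show s\<xi>: "square_integrable M (\<xi> t)"
    by (rule square_integrable_AE_cong[OF square_integrable_add[OF sc sq_m[OF tt]] meas[OF tt] \<xi>t])
  have "expectation (\<lambda>\<omega>. (\<xi> t \<omega>)\<^sup>2) = expectation (\<lambda>\<omega>. (c + a t \<omega>)\<^sup>2 + 2 * (c * m t \<omega> + a t \<omega> * m t \<omega>) + (m t \<omega>)\<^sup>2)"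
  proof (rule integral_cong_AE)
    show "AE \<omega> in M. (\<xi> t \<omega>)\<^sup>2 = (c + a t \<omega>)\<^sup>2 + 2 * (c * m t \<omega> + a t \<omega> * m t \<omega>) + (m t \<omega>)\<^sup>2"
      using \<xi>t
    proof eventually_elim
      case (elim \<omega>)
      show ?case unfolding elim[symmetric] by algebra
    qed
    show "(\<lambda>\<omega>. (c + a t \<omega>)\<^sup>2 + 2 * (c * m t \<omega> + a t \<omega> * m t \<omega>) + (m t \<omega>)\<^sup>2) \<in> borel_measurable M"
      by (intro borel_measurable_add borel_measurable_times borel_measurable_power borel_measurable_const
          a't_meas square_integrableD(1)[OF sq_m[OF tt]])
  qed (intro borel_measurable_power meas[OF tt])
  also have "\<dots> = expectation (\<lambda>\<omega>. (c + a t \<omega>)\<^sup>2) + 2 * (c * expectation (m t) + expectation (\<lambda>\<omega>. a t \<omega> * m t \<omega>))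
      + expectation (\<lambda>\<omega>. (m t \<omega>)\<^sup>2)"
    using square_integrableD(2)[OF sc] int[OF sat sq_m[OF tt]] square_integrableD(2)[OF sq_m[OF tt]]
      integrable_if_square_integrable[OF sq_m[OF tt]] by simp
  also have "expectation (\<lambda>\<omega>. a t \<omega> * m t \<omega>) = (\<integral>z. \<alpha>' z * (indicator {0..t} (fst z) * m t (snd z)) \<partial>?Q)"
  proof -
    have "integrable ?Q (\<lambda>(r, \<omega>). \<alpha>' (r, \<omega>) * (indicator {0..t} r * m t \<omega>))"
      using int[OF sa sI[OF sq_m[OF tt]]] by (simp add: case_prod_beta')
    from path.integral_snd[OF this]
    have "expectation (\<lambda>\<omega>. \<integral>r. \<alpha>' (r, \<omega>) * (indicator {0..t} r * m t \<omega>) \<partial>lborel)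
        = (\<integral>z. \<alpha>' z * (indicator {0..t} (fst z) * m t (snd z)) \<partial>?Q)"
      by (simp add: case_prod_beta')
    moreover have "(\<integral>r. \<alpha>' (r, \<omega>) * (indicator {0..t} r * m t \<omega>) \<partial>lborel) = a t \<omega> * m t \<omega>" for \<omega>
    proof -
      have "\<alpha>' (r, \<omega>) * (indicator {0..t} r * m t \<omega>) = (indicator {0..t} r * \<alpha>' (r, \<omega>)) * m t \<omega>" for r by simp
      thus ?thesis unfolding a_def by (simp only: integral_mult_left_zero)
    qed
    ultimately show ?thesis by simp
  qed
  also have "\<dots> = (\<integral>z. \<alpha>' z * (\<xi>' z - (indicator {0..t} (fst z) * c + a' z)) \<partial>?Q)"
  proof -
    note i1 = int[OF sa sI[OF sq_m[OF tt]]]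
    note i2 = int[OF sa square_integrable_diff[OF sx square_integrable_add[OF sI1 sa']]]
    have "(\<integral>s. expectation (\<lambda>\<omega>. \<alpha>' (s, \<omega>) * (indicator {0..t} (fst (s, \<omega>)) * m t (snd (s, \<omega>)))) \<partial>lborel)
      = (\<integral>s. expectation (\<lambda>\<omega>. \<alpha>' (s, \<omega>) * (\<xi>' (s, \<omega>) - (indicator {0..t} (fst (s, \<omega>)) * c + a' (s, \<omega>)))) \<partial>lborel)"
    \<comment> \<open>\<open>m s\<close> need not be jointly measurable in \<open>s\<close> and \<open>\<omega>\<close>, so it is eliminated for each \<open>s\<close> separately\<close>
    proof (rule integral_cong_AE)
      show "AE s in lborel. expectation (\<lambda>\<omega>. \<alpha>' (s, \<omega>) * (indicator {0..t} (fst (s, \<omega>)) * m t (snd (s, \<omega>))))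
        = expectation (\<lambda>\<omega>. \<alpha>' (s, \<omega>) * (\<xi>' (s, \<omega>) - (indicator {0..t} (fst (s, \<omega>)) * c + a' (s, \<omega>))))"
        using path.AE_integrable_fst'[OF square_integrableD(2)[OF sa]]
      proof eventually_elim
        case (elim s)
        show ?case
        proof (cases "s \<in> {0..t}")
          case False
          thus ?thesis by (simp add: \<alpha>'_def)
        next
          case True
          have eq: "\<alpha>' (s, \<omega>) = \<alpha> s \<omega>" "\<xi>' (s, \<omega>) = \<xi> s \<omega>" "a' (s, \<omega>) = a s \<omega>" for \<omega>
            using True by (simp_all add: \<alpha>'_def \<xi>'_def a'_def)
          have "(\<lambda>\<omega>. \<alpha>' (s, \<omega>)) \<in> borel_measurable M"
            using measurable_compose[OF measurable_Pair1'[of s lborel M] square_integrableD(1)[OF sa]] by simp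
          hence s\<alpha>: "square_integrable M (\<alpha> s)"
            using elim unfolding eq square_integrable_def by simp
          have "expectation (\<lambda>\<omega>. \<alpha> s \<omega> * m t \<omega>) = expectation (\<lambda>\<omega>. \<alpha> s \<omega> * m s \<omega>)"
            by (rule mart[OF True s\<alpha>])
          also have "\<dots> = expectation (\<lambda>\<omega>. \<alpha> s \<omega> * (\<xi> s \<omega> - (c + a s \<omega>)))"
          proof (rule integral_cong_AE)
            show "AE \<omega> in M. \<alpha> s \<omega> * m s \<omega> = \<alpha> s \<omega> * (\<xi> s \<omega> - (c + a s \<omega>))"
              using \<xi>[OF True] by eventually_elim (simp add: a_eq[OF True])
            show "(\<lambda>\<omega>. \<alpha> s \<omega> * m s \<omega>) \<in> borel_measurable M"
              by (intro borel_measurable_times square_integrableD(1) s\<alpha> sq_m True)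
            show "(\<lambda>\<omega>. \<alpha> s \<omega> * (\<xi> s \<omega> - (c + a s \<omega>))) \<in> borel_measurable M"
              by (intro borel_measurable_times borel_measurable_diff borel_measurable_add borel_measurable_const
                  square_integrableD(1)[OF s\<alpha>] meas True a't_meas)
          qed
          finally show ?thesis using True by (simp add: eq)
        qed
      qed
    qed (use borel_measurable_integrable[OF path.integrable_fst'[OF i1]] borel_measurable_integrable[OF path.integrable_fst'[OF i2]] in simp_all)
    thus ?thesis unfolding path.integral_fst'[OF i1] path.integral_fst'[OF i2] .
  qed
  also have "\<dots> = (\<integral>z. \<alpha>' z * \<xi>' z \<partial>?Q) - (\<integral>z. \<alpha>' z * (indicator {0..t} (fst z) * c + a' z) \<partial>?Q)"
    using int[OF sa sx] int[OF sa square_integrable_add[OF sI1 sa']]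
    by (simp add: right_diff_distrib)
  also have "expectation (\<lambda>\<omega>. (c + a t \<omega>)\<^sup>2) = c\<^sup>2 + 2 * (\<integral>z. \<alpha>' z * (indicator {0..t} (fst z) * c + a' z) \<partial>?Q)"
  proof -
    have i: "integrable ?Q (\<lambda>(s, \<omega>). \<alpha>' (s, \<omega>) * (indicator {0..t} s * c + a' (s, \<omega>)))"
      using int[OF sa square_integrable_add[OF sI1 sa']] by (simp add: case_prod_beta')
    have "expectation (\<lambda>\<omega>. (c + a t \<omega>)\<^sup>2) = expectation (\<lambda>\<omega>. c\<^sup>2 + 2 * (\<integral>s. \<alpha>' (s, \<omega>) * (indicator {0..t} s * c + a' (s, \<omega>)) \<partial>lborel))"
    proof (rule integral_cong_AE)
      show "AE \<omega> in M. (c + a t \<omega>)\<^sup>2 = c\<^sup>2 + 2 * (\<integral>s. \<alpha>' (s, \<omega>) * (indicator {0..t} s * c + a' (s, \<omega>)) \<partial>lborel)"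
        using cont
      proof eventually_elim
        case (elim \<omega>)
        have "(\<integral>s. \<alpha>' (s, \<omega>) * (indicator {0..t} s * c + a' (s, \<omega>)) \<partial>lborel)
            = (LINT s:{0..t}|lborel. \<alpha> s \<omega> * (c + (LINT r:{0..s}|lborel. \<alpha> r \<omega>)))"
          unfolding set_lebesgue_integral_def[of lborel "{0..t}"]
          by (intro Bochner_Integration.integral_cong refl) (auto simp: \<alpha>'_def a'_def a_eq indicator_def)
        thus ?case using square_of_absolutely_continuous[OF elim t, of c] a_eq[OF tt] by simp
      qed
      show "(\<lambda>\<omega>. (c + a t \<omega>)\<^sup>2) \<in> borel_measurable M"
        by (intro borel_measurable_power square_integrableD(1) sc)
      show "(\<lambda>\<omega>. c\<^sup>2 + 2 * (\<integral>s. \<alpha>' (s, \<omega>) * (indicator {0..t} s * c + a' (s, \<omega>)) \<partial>lborel)) \<in> borel_measurable M"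
        using borel_measurable_integrable[OF path.integrable_snd[OF i]]
        by (intro borel_measurable_add borel_measurable_times borel_measurable_const)
    qed
    also have "\<dots> = c\<^sup>2 + 2 * expectation (\<lambda>\<omega>. \<integral>s. \<alpha>' (s, \<omega>) * (indicator {0..t} s * c + a' (s, \<omega>)) \<partial>lborel)"
      using path.integrable_snd[OF i] by (simp add: prob_space)
    finally show ?thesis using path.integral_snd[OF i] by (simp add: case_prod_beta')
  qed
  also have "(\<lambda>z. \<alpha>' z * \<xi>' z) = (\<lambda>z. indicator {0..t} (fst z) * (\<alpha> (fst z) (snd z) * \<xi> (fst z) (snd z)))"
    by (auto simp: \<alpha>'_def \<xi>'_def indicator_def)
  finally show "expectation (\<lambda>\<omega>. (\<xi> t \<omega>)\<^sup>2) = c\<^sup>2 + 2 * (\<integral>z. indicator {0..t} (fst z) * (\<alpha> (fst z) (snd z) * \<xi> (fst z) (snd z)) \<partial>?Q)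
      + expectation (\<lambda>\<omega>. (m t \<omega>)\<^sup>2)"
    using m_mean by simp
qed

end

section \<open>The generalized Lyapunov operator\<close>

definition noise_operator :: "real ^ 'q ^ 'q \<Rightarrow> ('q \<Rightarrow> real ^ 'n ^ 'n) \<Rightarrow> real ^ 'n ^ 'n \<Rightarrow> real ^ 'n ^ 'n" where
  "noise_operator K N S = (\<Sum>i\<in>UNIV. \<Sum>j\<in>UNIV. K $ i $ j *\<^sub>R (N i ** S ** transpose (N j)))"

definition lyapunov_operator ::
  "real ^ 'n ^ 'n \<Rightarrow> real ^ 'q ^ 'q \<Rightarrow> ('q \<Rightarrow> real ^ 'n ^ 'n) \<Rightarrow> real ^ 'n ^ 'n \<Rightarrow> real ^ 'n ^ 'n" where
  "lyapunov_operator A K N S = A ** S + S ** transpose A + noise_operator K N S"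

lemma linear_noise_operator: "linear (noise_operator K N)"
  unfolding noise_operator_def[abs_def]
  by (intro linear_compose_sum ballI linear_compose_scale_right linear_matrix_sandwich)

lemma linear_lyapunov_operator: "linear (lyapunov_operator A K N)"
  unfolding lyapunov_operator_def[abs_def]
  using linear_matrix_sandwich[of A "mat 1"] linear_matrix_sandwich[of "mat 1" "transpose A"]
  by (intro linear_compose_add linear_noise_operator) simp_all

lemma quadratic_form_matrix_sandwich:
  "u \<bullet> ((B ** S ** transpose C) *v u) = (u v* B) \<bullet> (S *v (u v* C))"
  for B C S :: "real ^ 'n ^ 'n"
  by (simp add: matrix_vector_mul_assoc[symmetric] dot_lmul_matrix transpose_matrix_vector)

lemma quadratic_form_sum: "u \<bullet> ((\<Sum>i\<in>I. S i) *v u) = (\<Sum>i\<in>I. u \<bullet> (S i *v u))"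
  for S :: "'i \<Rightarrow> real ^ 'n ^ 'n"
  using linear_sum[OF bounded_linear.linear[OF bounded_linear_quadratic_form[of u]], of S I] .

lemma quadratic_form_scaleR: "u \<bullet> ((c *\<^sub>R S) *v u) = c * (u \<bullet> (S *v u))"
  for S :: "real ^ 'n ^ 'n"
  by (simp add: scaleR_matrix_vector_assoc[symmetric])

lemma quadratic_form_noise_operator:
  "u \<bullet> (noise_operator K N S *v u) = (\<Sum>i\<in>UNIV. \<Sum>j\<in>UNIV. K $ i $ j * ((u v* N i) \<bullet> (S *v (u v* N j))))"
  unfolding noise_operator_def quadratic_form_sum quadratic_form_scaleR quadratic_form_matrix_sandwich ..

lemma quadratic_form_lyapunov_operator:
  assumes "transpose S = S"
  shows "u \<bullet> (lyapunov_operator A K N S *v u) = 2 * ((u v* A) \<bullet> (S *v u)) +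
    (\<Sum>i\<in>UNIV. \<Sum>j\<in>UNIV. K $ i $ j * ((u v* N i) \<bullet> (S *v (u v* N j))))"
proof -
  have "u \<bullet> ((S ** transpose A) *v u) = (u v* S) \<bullet> (u v* A)"
    by (simp add: matrix_vector_mul_assoc[symmetric] dot_lmul_matrix transpose_matrix_vector)
  also have "u v* S = S *v u" using assms by (metis transpose_matrix_vector)
  finally have "u \<bullet> ((S ** transpose A) *v u) = (u v* A) \<bullet> (S *v u)" by (simp only: inner_commute)
  moreover have "u \<bullet> ((A ** S) *v u) = (u v* A) \<bullet> (S *v u)"
    by (simp add: matrix_vector_mul_assoc[symmetric] dot_lmul_matrix)
  ultimately show ?thesis
    by (simp add: lyapunov_operator_def matrix_vector_mult_add_rdistrib inner_add_right quadratic_form_noise_operator)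
qed

lemma transpose_add: "transpose (S + T) = transpose S + transpose T"
  for S T :: "real ^ 'n ^ 'm"
  by (simp add: transpose_def vec_eq_iff)

lemma transpose_sum: "transpose (\<Sum>i\<in>I. S i) = (\<Sum>i\<in>I. transpose (S i))"
  for S :: "'i \<Rightarrow> real ^ 'n ^ 'm"
  by (simp add: transpose_def vec_eq_iff)

lemma transpose_scaleR: "transpose (c *\<^sub>R S) = c *\<^sub>R transpose S"
  for S :: "real ^ 'n ^ 'm"
  by (simp add: transpose_def vec_eq_iff)

lemma bounded_linear_transpose: "bounded_linear (transpose :: real ^ 'n ^ 'm \<Rightarrow> _)"
  unfolding linear_conv_bounded_linear[symmetric]
  by (rule linearI) (simp_all add: transpose_add transpose_scaleR)

lemma transpose_lyapunov_operator:
  assumes S: "transpose S = S" and K: "\<And>i j. K $ i $ j = K $ j $ i"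
  shows "transpose (lyapunov_operator A K N S) = lyapunov_operator A K N S"
proof -
  have "transpose (noise_operator K N S) = (\<Sum>i\<in>UNIV. \<Sum>j\<in>UNIV. K $ j $ i *\<^sub>R (N j ** S ** transpose (N i)))"
    unfolding noise_operator_def transpose_sum transpose_scaleR
    by (intro sum.cong refl arg_cong2[where f = scaleR] K)
       (simp add: matrix_transpose_mul S matrix_mul_assoc)
  also have "\<dots> = noise_operator K N S"
    unfolding noise_operator_def by (rule sum.swap)
  finally have "transpose (noise_operator K N S) = noise_operator K N S" .
  thus ?thesis
    by (simp add: lyapunov_operator_def transpose_add matrix_transpose_mul S add.commute)
qed

section \<open>Second moments of the solution\<close>

context prob_space
begin

definition second_moment :: "('a \<Rightarrow> real ^ 'n) \<Rightarrow> real ^ 'n ^ 'n" where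
  "second_moment X = (\<chi> i j. expectation (\<lambda>\<omega>. X \<omega> $ i * X \<omega> $ j))"

lemma transpose_second_moment: "transpose (second_moment X) = second_moment X"
  by (simp add: transpose_def second_moment_def mult.commute)

lemma bilinear_form_second_moment:
  assumes "\<And>u. square_integrable M (\<lambda>\<omega>. u \<bullet> X \<omega>)"
  shows "u \<bullet> (second_moment X *v z) = expectation (\<lambda>\<omega>. (u \<bullet> X \<omega>) * (z \<bullet> X \<omega>))"
proof -
  have sq: "square_integrable M (\<lambda>\<omega>. X \<omega> $ i)" for i
    using assms[of "axis i 1"] by (simp add: inner_axis')
  have i: "integrable M (\<lambda>\<omega>. (u $ i * z $ j) * (X \<omega> $ i * X \<omega> $ j))" for i j
    using integrable_mult_square_integrable[OF sq[of i] sq[of j]] by simp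
  have "expectation (\<lambda>\<omega>. (u \<bullet> X \<omega>) * (z \<bullet> X \<omega>))
      = expectation (\<lambda>\<omega>. \<Sum>i\<in>UNIV. \<Sum>j\<in>UNIV. (u $ i * z $ j) * (X \<omega> $ i * X \<omega> $ j))"
    by (simp add: inner_vec_def sum_product mult.assoc mult.left_commute)
  also have "\<dots> = (\<Sum>i\<in>UNIV. expectation (\<lambda>\<omega>. \<Sum>j\<in>UNIV. (u $ i * z $ j) * (X \<omega> $ i * X \<omega> $ j)))"
    using i by (intro Bochner_Integration.integral_sum Bochner_Integration.integrable_sum)
  also have "\<dots> = (\<Sum>i\<in>UNIV. \<Sum>j\<in>UNIV. expectation (\<lambda>\<omega>. (u $ i * z $ j) * (X \<omega> $ i * X \<omega> $ j)))"
    using i by (intro sum.cong refl Bochner_Integration.integral_sum)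
  also have "\<dots> = u \<bullet> (second_moment X *v z)"
    by (simp add: inner_vec_def matrix_vector_mult_def second_moment_def sum_distrib_left ac_simps)
  finally show ?thesis by simp
qed

end

context wiener_process
begin

lemma expectation_ito_limit:
  assumes "ito_limit i f J"
  shows "expectation J = 0"
proof -
  obtain m a b \<phi> where e: "\<And>n. elementary (m n) (a n) (b n) (\<phi> n)"
    and lim: "L2_tendsto M (\<lambda>n. elementary_integral i (m n) (a n) (b n) (\<phi> n)) J"
    using assms unfolding ito_limit_def by blast
  have one: "(\<lambda>_. 1) \<in> borel_measurable (F 0)" "square_integrable M (\<lambda>_. 1)"
    by (simp_all add: square_integrable_def)
  have zero: "expectation (\<lambda>\<omega>. 1 * elementary_integral i (m n) (a n) (b n) (\<phi> n) \<omega>) = 0" for n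
  proof -
    have min: "min (a n k) 0 = 0" "min (b n k) 0 = 0" if "k < m n" for k
      using elementaryD(1,2)[OF e that] by auto
    have "elementary_integral i (m n) (\<lambda>k. min (a n k) 0) (\<lambda>k. min (b n k) 0)
        (\<lambda>k \<omega>. if a n k \<le> 0 then \<phi> n k \<omega> else 0) \<omega> = 0" for \<omega>
      unfolding elementary_integral_def using min by (intro sum.neutral) simp
    thus ?thesis
      unfolding expectation_past_mult_elementary_integral[OF e order_refl one] by simp
  qed
  have "L2_tendsto M (\<lambda>_ _. 1) (\<lambda>_. 1)" using one by (simp add: L2_tendsto_def)
  from L2_tendsto_inner[OF this lim] have "(\<lambda>n. 0::real) \<longlonglongrightarrow> expectation (\<lambda>\<omega>. 1 * J \<omega>)"
    unfolding zero .
  thus ?thesis by (simp add: LIMSEQ_const_iff)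
qed

text \<open>For each \<open>s\<close> the equation supplies its own version \<open>J s i\<close> of the stochastic integrals, and
  \<open>m s\<close> is the scalar process built from them; no regularity of \<open>m\<close> in \<open>s\<close> is available.\<close>

lemma linear_sde_second_moment:
  fixes A :: "real ^ 'n ^ 'n" and N :: "'q \<Rightarrow> real ^ 'n ^ 'n"
  assumes sol: "linear_sde_solution M F w A N x0 x" and t: "0 \<le> t"
  shows "square_integrable M (\<lambda>\<omega>. u \<bullet> x t \<omega>)"
    and "expectation (\<lambda>\<omega>. (u \<bullet> x t \<omega>)\<^sup>2) = (u \<bullet> x0)\<^sup>2
      + 2 * (\<integral>z. indicator {0..t} (fst z) * (((u v* A) \<bullet> x (fst z) (snd z)) * (u \<bullet> x (fst z) (snd z))) \<partial>(lborel \<Otimes>\<^sub>M M))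
      + (\<Sum>i\<in>UNIV. \<Sum>j\<in>UNIV. K $ i $ j * (\<integral>z. indicator {0..t} (fst z) *
          (((u v* N i) \<bullet> x (fst z) (snd z)) * ((u v* N j) \<bullet> x (fst z) (snd z))) \<partial>(lborel \<Otimes>\<^sub>M M)))"
proof -
  let ?Q = "lborel \<Otimes>\<^sub>M M"
  have ito: "ito_integrand M F s x" if "0 \<le> s" for s
    using sol that by (auto simp: linear_sde_solution_def)
  have cont: "AE \<omega> in M. continuous_on {0..} (\<lambda>s. x s \<omega>)"
    using sol by (auto simp: linear_sde_solution_def)
  have "\<forall>s\<in>{0..}. \<exists>J. (\<forall>i. has_ito_integral M F (\<lambda>s \<omega>. w s \<omega> $ i) s (\<lambda>s \<omega>. N i *v x s \<omega>) (J i)) \<and>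
        (AE \<omega> in M. x s \<omega> = x0 + (LINT r:{0..s}|lborel. A *v x r \<omega>) + (\<Sum>i\<in>UNIV. J i \<omega>))"
    using sol by (auto simp: linear_sde_solution_def)
  then obtain J where J: "\<And>s i. 0 \<le> s \<Longrightarrow> has_ito_integral M F (\<lambda>s \<omega>. w s \<omega> $ i) s (\<lambda>s \<omega>. N i *v x s \<omega>) (J s i)"
    and x: "\<And>s. 0 \<le> s \<Longrightarrow> AE \<omega> in M. x s \<omega> = x0 + (LINT r:{0..s}|lborel. A *v x r \<omega>) + (\<Sum>i\<in>UNIV. J s i \<omega>)"
    unfolding bchoice_iff by fastforce
  define f where "f i z = (u v* N i) \<bullet> x (fst z) (snd z)" for i and z :: "real \<times> 'a"
  define m where "m s \<omega> = (\<Sum>i\<in>UNIV. u \<bullet> J s i \<omega>)" for s \<omega>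
  define \<alpha> where "\<alpha> s \<omega> = (u v* A) \<bullet> x s \<omega>" for s \<omega>
  have lim: "ito_limit i (\<lambda>z. indicator {0..s} (fst z) * f i z) (\<lambda>\<omega>. u \<bullet> J s i \<omega>)" if "0 \<le> s" for s i
    using has_ito_integral_imp_ito_limit[OF J[OF that] that, of i u] by (simp add: f_def dot_lmul_matrix)
  have sqJ: "square_integrable M (\<lambda>\<omega>. u \<bullet> J s i \<omega>)" if "0 \<le> s" for s i
    by (rule ito_limit_square_integrable(2)[OF lim[OF that]])
  have x_meas: "x s \<in> borel_measurable (F s)" if "0 \<le> s" for s
    using ito[OF that] that by (intro progressive_section_measurable) (auto simp: ito_integrand_def)
  have ux_meas: "(\<lambda>\<omega>. y \<bullet> x s \<omega>) \<in> borel_measurable (F s)" if "0 \<le> s" for s y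
    using x_meas[OF that] by (intro borel_measurable_inner) simp_all
  have mart: "expectation (\<lambda>\<omega>. \<alpha> s \<omega> * m t \<omega>) = expectation (\<lambda>\<omega>. \<alpha> s \<omega> * m s \<omega>)"
    if s: "s \<in> {0..t}" and sq: "square_integrable M (\<alpha> s)" for s
  proof -
    have s0: "0 \<le> s" using s by simp
    have expand: "expectation (\<lambda>\<omega>. \<alpha> s \<omega> * m r \<omega>) = (\<Sum>i\<in>UNIV. expectation (\<lambda>\<omega>. \<alpha> s \<omega> * (u \<bullet> J r i \<omega>)))" if "0 \<le> r" for r
      unfolding m_def sum_distrib_left
      by (intro Bochner_Integration.integral_sum integrable_mult_square_integrable[OF sq sqJ[OF that]])
    have "expectation (\<lambda>\<omega>. \<alpha> s \<omega> * (u \<bullet> J t i \<omega>)) = expectation (\<lambda>\<omega>. \<alpha> s \<omega> * (u \<bullet> J s i \<omega>))" for i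
    proof (rule expectation_past_mult_ito_limit[OF lim[OF t] _ s0 _ sq])
      have eq: "indicator {..s} (fst z) * (indicator {0..t} (fst z) * f i z) = indicator {0..s} (fst z) * f i z" for z
        using s by (auto simp: indicator_def)
      show "ito_limit i (\<lambda>z. indicator {..s} (fst z) * (indicator {0..t} (fst z) * f i z)) (\<lambda>\<omega>. u \<bullet> J s i \<omega>)"
        unfolding eq by (rule lim[OF s0])
      show "\<alpha> s \<in> borel_measurable (F s)" unfolding \<alpha>_def[abs_def] by (rule ux_meas[OF s0])
    qed
    thus ?thesis unfolding expand[OF t] expand[OF s0] by simp
  qed
  have mean: "expectation (m t) = 0"
    unfolding m_def
    using expectation_ito_limit[OF lim[OF t]] integrable_if_square_integrable[OF sqJ[OF t]] by simp
  have sq_m: "square_integrable M (m s)" if "s \<in> {0..t}" for s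
    unfolding m_def[abs_def] using sqJ that by (intro square_integrable_sum) auto
  have \<xi>: "AE \<omega> in M. u \<bullet> x s \<omega> = u \<bullet> x0 + (LINT r:{0..s}|lborel. \<alpha> r \<omega>) + m s \<omega>" if "s \<in> {0..t}" for s
  proof -
    have "0 \<le> s" using that by simp
    from x[OF this] cont show ?thesis
    proof eventually_elim
      case (elim \<omega>)
      have "continuous_on {0..s} (\<lambda>r. x r \<omega>)" using elim(2) by (rule continuous_on_subset) simp
      hence "continuous_on {0..s} (\<lambda>r. A *v x r \<omega>)"
        by (rule linear_continuous_on_compose) simp
      hence int: "set_integrable lborel {0..s} (\<lambda>r. A *v x r \<omega>)"
        by (rule borel_integrable_atLeastAtMost')
      have "(LINT r:{0..s}|lborel. \<alpha> r \<omega>) = (\<integral>r. u \<bullet> (indicator {0..s} r *\<^sub>R (A *v x r \<omega>)) \<partial>lborel)"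
        by (simp add: set_lebesgue_integral_def \<alpha>_def dot_lmul_matrix)
      also have "\<dots> = u \<bullet> (LINT r:{0..s}|lborel. A *v x r \<omega>)"
        unfolding set_lebesgue_integral_def using int unfolding set_integrable_def
        by (intro integral_inner_right) simp
      finally have i: "(LINT r:{0..s}|lborel. \<alpha> r \<omega>) = u \<bullet> (LINT r:{0..s}|lborel. A *v x r \<omega>)" .
      show ?case unfolding i elim(1) m_def by (simp add: inner_add_right inner_sum_right)
    qed
  qed
  have cont\<alpha>: "AE \<omega> in M. continuous_on {0..t} (\<lambda>s. \<alpha> s \<omega>)"
    using cont
  proof eventually_elim
    case (elim \<omega>)
    have "continuous_on {0..t} (\<lambda>r. x r \<omega>)" using elim by (rule continuous_on_subset) simp
    thus ?case unfolding \<alpha>_def by (intro continuous_intros)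
  qed
  have sq_\<alpha>: "square_integrable ?Q (\<lambda>z. indicator {0..t} (fst z) * \<alpha> (fst z) (snd z))"
    unfolding \<alpha>_def by (rule ito_integrand_square_integrable[OF ito[OF t] t])
  have sq_\<xi>: "square_integrable ?Q (\<lambda>z. indicator {0..t} (fst z) * (u \<bullet> x (fst z) (snd z)))"
    by (rule ito_integrand_square_integrable[OF ito[OF t] t])
  have meas: "(\<lambda>\<omega>. u \<bullet> x s \<omega>) \<in> borel_measurable M" if "s \<in> {0..t}" for s
    using measurable_filtration[OF ux_meas] that by simp
  have concl: "square_integrable M (\<lambda>\<omega>. u \<bullet> x t \<omega>)"
    "expectation (\<lambda>\<omega>. (u \<bullet> x t \<omega>)\<^sup>2) = (u \<bullet> x0)\<^sup>2
      + 2 * (\<integral>z. indicator {0..t} (fst z) * (\<alpha> (fst z) (snd z) * (u \<bullet> x (fst z) (snd z))) \<partial>?Q)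
      + expectation (\<lambda>\<omega>. (m t \<omega>)\<^sup>2)"
    by (rule second_moment_drift_plus_martingale[OF t sq_\<alpha> sq_\<xi> sq_m meas \<xi> cont\<alpha> _ mean];
        (assumption | rule mart; assumption))+
  show "square_integrable M (\<lambda>\<omega>. u \<bullet> x t \<omega>)" by (rule concl(1))
  have "expectation (\<lambda>\<omega>. (m t \<omega>)\<^sup>2) = expectation (\<lambda>\<omega>. \<Sum>i\<in>UNIV. \<Sum>j\<in>UNIV. (u \<bullet> J t i \<omega>) * (u \<bullet> J t j \<omega>))"
    by (simp add: m_def power2_eq_square sum_product)
  also have "\<dots> = (\<Sum>i\<in>UNIV. expectation (\<lambda>\<omega>. \<Sum>j\<in>UNIV. (u \<bullet> J t i \<omega>) * (u \<bullet> J t j \<omega>)))"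
    by (intro Bochner_Integration.integral_sum Bochner_Integration.integrable_sum integrable_mult_square_integrable sqJ t)
  also have "\<dots> = (\<Sum>i\<in>UNIV. \<Sum>j\<in>UNIV. expectation (\<lambda>\<omega>. (u \<bullet> J t i \<omega>) * (u \<bullet> J t j \<omega>)))"
    by (intro sum.cong refl Bochner_Integration.integral_sum integrable_mult_square_integrable sqJ t)
  also have "\<dots> = (\<Sum>i\<in>UNIV. \<Sum>j\<in>UNIV. K $ i $ j * (\<integral>z. indicator {0..t} (fst z) * (f i z * f j z) \<partial>?Q))"
  proof (intro sum.cong refl)
    fix i j
    have eq: "(indicator {0..t} (fst z) * f i z) * (indicator {0..t} (fst z) * f j z) = indicator {0..t} (fst z) * (f i z * f j z)" for z
      by (auto simp: indicator_def)
    show "expectation (\<lambda>\<omega>. (u \<bullet> J t i \<omega>) * (u \<bullet> J t j \<omega>)) = K $ i $ j * (\<integral>z. indicator {0..t} (fst z) * (f i z * f j z) \<partial>?Q)"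
      using ito_isometry[OF lim[OF t] lim[OF t], of i j] unfolding eq .
  qed
  finally show "expectation (\<lambda>\<omega>. (u \<bullet> x t \<omega>)\<^sup>2) = (u \<bullet> x0)\<^sup>2
      + 2 * (\<integral>z. indicator {0..t} (fst z) * (((u v* A) \<bullet> x (fst z) (snd z)) * (u \<bullet> x (fst z) (snd z))) \<partial>?Q)
      + (\<Sum>i\<in>UNIV. \<Sum>j\<in>UNIV. K $ i $ j * (\<integral>z. indicator {0..t} (fst z) *
          (((u v* N i) \<bullet> x (fst z) (snd z)) * ((u v* N j) \<bullet> x (fst z) (snd z))) \<partial>?Q))"
    using concl(2) by (simp add: \<alpha>_def f_def)
qed

end

lemma matrix_integrable_on_componentwise:
  fixes Y :: "real \<Rightarrow> real ^ 'n ^ 'm"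
  assumes "\<And>i j. (\<lambda>s. Y s $ i $ j) integrable_on S"
  shows "Y integrable_on S"
proof (rule integrable_componentwise)
  fix b :: "real ^ 'n ^ 'm" assume "b \<in> Basis"
  then obtain i j where "b = axis i (axis j 1)" by (auto simp: Basis_vec_def)
  thus "(\<lambda>s. Y s \<bullet> b) integrable_on S" using assms[of i j] by (simp add: inner_axis)
qed

lemma quadratic_form_outer_product:
  fixes y :: "real ^ 'n"
  shows "u \<bullet> ((\<chi> i j. y $ i * y $ j) *v u) = (u \<bullet> y)\<^sup>2"
proof -
  have "(\<chi> i j. y $ i * y $ j) *v u = (u \<bullet> y) *\<^sub>R y"
    by (simp add: vec_eq_iff matrix_vector_mult_def inner_vec_def sum_distrib_left ac_simps)
  thus ?thesis by (simp add: power2_eq_square)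
qed

context wiener_process
begin

interpretation path: pair_sigma_finite lborel M ..

lemma
  fixes x :: "real \<Rightarrow> 'a \<Rightarrow> real ^ 'n"
  assumes sol: "linear_sde_solution M F w A N x0 x" and t: "0 \<le> t"
  shows set_integrable_second_moment:
      "set_integrable lborel {0..t} (\<lambda>s. u \<bullet> (second_moment (x s) *v z))"
    and integral_path_eq_integral_second_moment:
      "(\<integral>y. indicator {0..t} (fst y) * ((u \<bullet> x (fst y) (snd y)) * (z \<bullet> x (fst y) (snd y))) \<partial>(lborel \<Otimes>\<^sub>M M))
        = integral {0..t} (\<lambda>s. u \<bullet> (second_moment (x s) *v z))"
proof -
  let ?g = "\<lambda>y. indicator {0..t} (fst y) * ((u \<bullet> x (fst y) (snd y)) * (z \<bullet> x (fst y) (snd y)))"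
  have ito: "ito_integrand M F t x" using sol t by (auto simp: linear_sde_solution_def)
  have eq: "(indicator {0..t} (fst y) * (u \<bullet> x (fst y) (snd y))) * (indicator {0..t} (fst y) * (z \<bullet> x (fst y) (snd y))) = ?g y" for y
    by (auto simp: indicator_def)
  have int: "integrable (lborel \<Otimes>\<^sub>M M) ?g"
    using integrable_mult_square_integrable[OF ito_integrand_square_integrable[OF ito t, of u] ito_integrand_square_integrable[OF ito t, of z]]
    unfolding eq .
  have eq: "expectation (\<lambda>\<omega>. ?g (s, \<omega>)) = indicator {0..t} s *\<^sub>R (u \<bullet> (second_moment (x s) *v z))" for s
  proof (cases "s \<in> {0..t}")
    case True
    hence "\<And>y. square_integrable M (\<lambda>\<omega>. y \<bullet> x s \<omega>)"
      using linear_sde_second_moment(1)[OF sol] by simp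
    from bilinear_form_second_moment[OF this] show ?thesis using True by simp
  qed simp
  show *: "set_integrable lborel {0..t} (\<lambda>s. u \<bullet> (second_moment (x s) *v z))"
    using path.integrable_fst'[OF int] unfolding eq set_integrable_def .
  show "(\<integral>y. ?g y \<partial>(lborel \<Otimes>\<^sub>M M)) = integral {0..t} (\<lambda>s. u \<bullet> (second_moment (x s) *v z))"
    unfolding set_borel_integral_eq_integral(2)[OF *, symmetric]
    using path.integral_fst'[OF int] unfolding eq set_lebesgue_integral_def by simp
qed

lemma second_moment_integrable_on:
  assumes sol: "linear_sde_solution M F w A N x0 x" and t: "0 \<le> t"
  shows "(\<lambda>s. second_moment (x s)) integrable_on {0..t}"
proof (rule matrix_integrable_on_componentwise)
  fix i j
  have "axis i 1 \<bullet> (S *v axis j 1) = S $ i $ j" for S :: "real ^ 'b ^ 'b"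
    by (simp add: inner_axis' matrix_vector_mult_basis column_def)
  thus "(\<lambda>s. second_moment (x s) $ i $ j) integrable_on {0..t}"
    using set_borel_integral_eq_integral(1)[OF set_integrable_second_moment[OF sol t, of "axis i 1" "axis j 1"]] by simp
qed

text \<open>Both sides are symmetric matrices, and their quadratic forms agree by
  \<open>linear_sde_second_moment\<close>.\<close>

lemma second_moment_integral_equation:
  assumes sol: "linear_sde_solution M F w A N x0 x" and t: "0 \<le> t"
  shows "second_moment (x t) = (\<chi> i j. x0 $ i * x0 $ j) + lyapunov_operator A K N (integral {0..t} (\<lambda>s. second_moment (x s)))"
proof -
  define Z where "Z = integral {0..t} (\<lambda>s. second_moment (x s))"
  define X where "X = (\<chi> i j. x0 $ i * x0 $ j)"
  note int = second_moment_integrable_on[OF sol t]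
  have lin: "integral {0..t} (\<lambda>s. u \<bullet> (second_moment (x s) *v z)) = u \<bullet> (Z *v z)" for u z
  proof -
    have "bounded_linear (\<lambda>S :: real ^ 'b ^ 'b. u \<bullet> (S *v z))"
      unfolding linear_conv_bounded_linear[symmetric]
      by (rule linearI) (simp_all add: matrix_vector_mult_add_rdistrib inner_add_right scaleR_matrix_vector_assoc[symmetric])
    from integral_linear[OF int this] show ?thesis by (simp add: o_def Z_def)
  qed
  from integral_linear[OF int bounded_linear_transpose] have symZ: "transpose Z = Z"
    by (simp add: o_def Z_def transpose_second_moment)
  have symX: "transpose X = X" by (simp add: X_def transpose_def mult.commute)
  have formX: "u \<bullet> (X *v u) = (u \<bullet> x0)\<^sup>2" for u
    unfolding X_def by (rule quadratic_form_outer_product)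
  have sq: "\<And>u. square_integrable M (\<lambda>\<omega>. u \<bullet> x t \<omega>)" by (rule linear_sde_second_moment(1)[OF sol t])
  have "second_moment (x t) - (X + lyapunov_operator A K N Z) = 0"
  proof (rule matrix_eq_0_if_quadratic_form_eq_0)
    show "transpose (second_moment (x t) - (X + lyapunov_operator A K N Z)) = second_moment (x t) - (X + lyapunov_operator A K N Z)"
      using transpose_second_moment[of "x t"] symX transpose_lyapunov_operator[OF symZ covariance_symmetric, of A N]
      by (simp add: vec_eq_iff transpose_def)
    fix u
    have "u \<bullet> (second_moment (x t) *v u) = expectation (\<lambda>\<omega>. (u \<bullet> x t \<omega>)\<^sup>2)"
      using bilinear_form_second_moment[OF sq] by (simp add: power2_eq_square)
    also have "\<dots> = u \<bullet> ((X + lyapunov_operator A K N Z) *v u)"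
      unfolding linear_sde_second_moment(2)[OF sol t] integral_path_eq_integral_second_moment[OF sol t] lin
        matrix_vector_mult_add_rdistrib inner_add_right quadratic_form_lyapunov_operator[OF symZ] formX
      by simp
    finally show "u \<bullet> ((second_moment (x t) - (X + lyapunov_operator A K N Z)) *v u) = 0"
      by (simp add: matrix_vector_mult_diff_rdistrib inner_diff_right)
  qed
  thus ?thesis by (simp add: X_def Z_def)
qed

text \<open>The integral equation bootstraps regularity: its right-hand side is continuous in \<open>t\<close>
  since \<open>Y\<close> is integrable, hence \<open>Y\<close> is continuous.\<close>

lemma integral_second_moment_has_derivative:
  assumes sol: "linear_sde_solution M F w A N x0 x" and t: "t \<in> {0..T}"
  shows "((\<lambda>t. integral {0..t} (\<lambda>s. second_moment (x s))) has_vector_derivative second_moment (x t)) (at t within {0..T})"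
proof (rule integral_has_vector_derivative[OF _ t])
  have "continuous_on {0..T} (\<lambda>t. integral {0..t} (\<lambda>s. second_moment (x s)))"
    using second_moment_integrable_on[OF sol, of T] t by (intro indefinite_integral_continuous_1) simp
  hence "continuous_on {0..T} (\<lambda>t. (\<chi> i j. x0 $ i * x0 $ j) + lyapunov_operator A K N (integral {0..t} (\<lambda>s. second_moment (x s))))"
    using linear_continuous_on_compose[OF _ linear_lyapunov_operator] by (intro continuous_on_add continuous_on_const) blast
  thus "continuous_on {0..T} (\<lambda>t. second_moment (x t))"
    by (rule continuous_on_eq) (use second_moment_integral_equation[OF sol] in simp)
qed

text \<open>The difference \<open>R\<close> of the two sides starts in the positive semidefinite cone and solves
  \<open>R' = L R + D\<close>, where \<open>D\<close> is positive semidefinite because \<open>(u \<bullet> X\<^sub>0 v)\<^sup>2 \<le> \<parallel>v\<parallel>\<^sup>2 \<parallel>X\<^sub>0\<^sup>T u\<parallel>\<^sup>2\<close>.\<close>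

lemma integral_second_moment_le:
  fixes X0 :: "real ^ 'd ^ 'n" and P :: "real ^ 'n ^ 'n"
  assumes sol: "linear_sde_solution M F w A N (X0 *v v) x" and T: "0 \<le> T"
    and P: "positive_semidefinite P"
    and lyap: "lyapunov_operator A K N P + X0 ** transpose X0 = 0"
  shows "u \<bullet> (integral {0..T} (\<lambda>s. second_moment (x s)) *v u) \<le> (norm v)\<^sup>2 * (u \<bullet> (P *v u))"
proof -
  define Z where "Z t = integral {0..t} (\<lambda>s. second_moment (x s))" for t
  define X where "X = (\<chi> i j. (X0 *v v) $ i * (X0 *v v) $ j)"
  define c where "c = (norm v)\<^sup>2"
  define R where "R t = c *\<^sub>R P - Z t" for t
  define D where "D = c *\<^sub>R (X0 ** transpose X0) - X"
  have linL: "linear (lyapunov_operator A K N)" by (rule linear_lyapunov_operator)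
  have LP: "lyapunov_operator A K N P = - (X0 ** transpose X0)" using lyap by (simp add: eq_neg_iff_add_eq_0)
  have "0 \<le> u \<bullet> (R T *v u)"
  proof (rule quasi_monotone_flow_nonneg[where \<Phi> = "noise_operator K N" and A = A and D = D and T = T])
    show "linear (noise_operator K N)" by (rule linear_noise_operator)
    show "0 \<le> u \<bullet> (noise_operator K N S *v u)" if "positive_semidefinite S" for S u
      unfolding quadratic_form_noise_operator by (rule covariance_weighted_form_nonneg[OF that])
    show "T \<in> {0..T}" using T by simp
    fix t assume t: "t \<in> {0..T}"
    have Y: "second_moment (x t) = X + lyapunov_operator A K N (Z t)"
      using second_moment_integral_equation[OF sol] t by (simp add: X_def Z_def)
    have "(R has_vector_derivative - second_moment (x t)) (at t within {0..T})"
      unfolding R_def Z_def using integral_second_moment_has_derivative[OF sol t]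
      by (auto intro!: derivative_eq_intros)
    also have "- second_moment (x t) = lyapunov_operator A K N (R t) + D"
      unfolding Y R_def D_def linear_diff[OF linL] linear_scale[OF linL] LP by simp
    finally show "(R has_vector_derivative A ** R t + R t ** transpose A + noise_operator K N (R t) + D) (at t within {0..T})"
      by (simp only: lyapunov_operator_def)
    from integral_linear[OF second_moment_integrable_on[OF sol] bounded_linear_transpose] t have "transpose (Z t) = Z t"
      by (simp add: o_def Z_def transpose_second_moment)
    thus "transpose (R t) = R t"
      using P by (simp add: R_def positive_semidefinite_def transpose_def vec_eq_iff)
  next
    fix u
    have "Z 0 = 0" by (simp add: Z_def)
    thus "0 \<le> u \<bullet> (R 0 *v u)" using P by (simp add: R_def c_def positive_semidefinite_def quadratic_form_scaleR)
    have "u \<bullet> ((X0 ** transpose X0) *v u) = (norm (u v* X0))\<^sup>2"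
      by (simp add: matrix_vector_mul_assoc[symmetric] dot_lmul_matrix[symmetric] transpose_matrix_vector power2_norm_eq_inner)
    moreover have "u \<bullet> (X *v u) = ((u v* X0) \<bullet> v)\<^sup>2"
      unfolding dot_lmul_matrix X_def by (rule quadratic_form_outer_product)
    moreover have "((u v* X0) \<bullet> v)\<^sup>2 \<le> c * (norm (u v* X0))\<^sup>2"
      using Cauchy_Schwarz_ineq[of "u v* X0" v] by (simp add: c_def power2_norm_eq_inner mult.commute)
    ultimately show "0 \<le> u \<bullet> (D *v u)"
      by (simp add: D_def matrix_vector_mult_diff_rdistrib inner_diff_right quadratic_form_scaleR)
  qed
  thus ?thesis
    by (simp add: R_def Z_def c_def matrix_vector_mult_diff_rdistrib inner_diff_right quadratic_form_scaleR)
qed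

end

section \<open>The bound along the eigenvectors\<close>

theorem proposition4p2:
  fixes M :: "'a measure" and F :: "real \<Rightarrow> 'a measure"
    and K :: "real ^ 'q ^ 'q" and w :: "real \<Rightarrow> 'a \<Rightarrow> real ^ 'q"
    and A :: "real ^ 'n ^ 'n" and N :: "'q \<Rightarrow> real ^ 'n ^ 'n"
    and X0 :: "real ^ 'd ^ 'n" and v :: "real ^ 'd"
    and x :: "real \<Rightarrow> 'a \<Rightarrow> real ^ 'n"
    and P :: "real ^ 'n ^ 'n" and p :: "'n \<Rightarrow> real ^ 'n" and lam :: "'n \<Rightarrow> real"
  assumes "wiener_process M F K w"
    and "mean_square_asymptotically_stable M F w A N"
    and "linear_sde_solution M F w A N (X0 *v v) x"
    and "positive_semidefinite P"
    and "A ** P + P ** transpose A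
         + (\<Sum>i\<in>UNIV. \<Sum>j\<in>UNIV. K $ i $ j *\<^sub>R (N i ** P ** transpose (N j)))
         + X0 ** transpose X0 = 0"
    and "orthonormal_basis p"
    and "\<forall>k. P *v p k = lam k *\<^sub>R p k"
    and "\<forall>k. 0 \<le> lam k"
  shows "\<forall>k. (\<integral>\<^sup>+t\<in>{0..}. (\<integral>\<^sup>+\<omega>. ennreal (\<bar>x t \<omega> \<bullet> p k\<bar>\<^sup>2) \<partial>M) \<partial>lborel)
             \<le> ennreal (lam k * (norm v)\<^sup>2)"
proof
  fix k
  interpret wiener_process M F K w by fact
  note sol = assms(3)
  define g where "g t = p k \<bullet> (second_moment (x t) *v p k)" for t
  have lyap: "lyapunov_operator A K N P + X0 ** transpose X0 = 0"
    using assms(5) by (simp only: lyapunov_operator_def noise_operator_def)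
  have g_eq: "(\<integral>\<^sup>+\<omega>. ennreal (\<bar>x t \<omega> \<bullet> p k\<bar>\<^sup>2) \<partial>M) = ennreal (g t)" and g_nonneg: "0 \<le> g t" if "0 \<le> t" for t
  proof -
    have sq: "\<And>u. square_integrable M (\<lambda>\<omega>. u \<bullet> x t \<omega>)" by (rule linear_sde_second_moment(1)[OF sol that])
    have "g t = expectation (\<lambda>\<omega>. (p k \<bullet> x t \<omega>)\<^sup>2)"
      unfolding g_def bilinear_form_second_moment[OF sq] by (simp add: power2_eq_square)
    thus "0 \<le> g t" "(\<integral>\<^sup>+\<omega>. ennreal (\<bar>x t \<omega> \<bullet> p k\<bar>\<^sup>2) \<partial>M) = ennreal (g t)"
      using square_integrableD(2)[OF sq[of "p k"]] by (simp_all add: nn_integral_eq_integral inner_commute)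
  qed
  have int: "set_integrable lborel {0..T} g" if "0 \<le> T" for T
    unfolding g_def[abs_def] by (rule set_integrable_second_moment[OF sol that])
  have bound: "(\<integral>\<^sup>+t\<in>{0..T}. ennreal (g t) \<partial>lborel) \<le> ennreal (lam k * (norm v)\<^sup>2)" if T: "0 \<le> T" for T
  proof -
    have "(\<integral>\<^sup>+t\<in>{0..T}. ennreal (g t) \<partial>lborel) = (\<integral>\<^sup>+t. ennreal (indicator {0..T} t *\<^sub>R g t) \<partial>lborel)"
      by (intro nn_integral_cong) (simp add: indicator_def)
    also have "\<dots> = ennreal (\<integral>t. indicator {0..T} t *\<^sub>R g t \<partial>lborel)"
      using int[OF T] g_nonneg unfolding set_integrable_def
      by (intro nn_integral_eq_integral AE_I2) (simp_all add: indicator_def)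
    also have "(\<integral>t. indicator {0..T} t *\<^sub>R g t \<partial>lborel) = integral {0..T} g"
      using set_borel_integral_eq_integral(2)[OF int[OF T]] by (simp only: set_lebesgue_integral_def)
    also have "integral {0..T} g = p k \<bullet> (integral {0..T} (\<lambda>s. second_moment (x s)) *v p k)"
      using integral_linear[OF second_moment_integrable_on[OF sol T] bounded_linear_quadratic_form[of "p k"]]
      by (simp add: o_def g_def[abs_def])
    also have "\<dots> \<le> (norm v)\<^sup>2 * (p k \<bullet> (P *v p k))"
      by (rule integral_second_moment_le[OF sol T assms(4) lyap])
    also have "p k \<bullet> (P *v p k) = lam k"
      using assms(6,7) by (simp add: orthonormal_basis_def)
    finally show ?thesis by (simp add: mult.commute ennreal_leI)
  qed
  have "(\<integral>\<^sup>+t\<in>{0..}. (\<integral>\<^sup>+\<omega>. ennreal (\<bar>x t \<omega> \<bullet> p k\<bar>\<^sup>2) \<partial>M) \<partial>lborel) = (\<integral>\<^sup>+t. (SUP n. ennreal (g t) * indicator {0..real n} t) \<partial>lborel)"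
  proof (rule nn_integral_cong)
    fix t :: real
    show "(\<integral>\<^sup>+\<omega>. ennreal (\<bar>x t \<omega> \<bullet> p k\<bar>\<^sup>2) \<partial>M) * indicator {0..} t = (SUP n. ennreal (g t) * indicator {0..real n} t)"
    proof (cases "0 \<le> t")
      case True
      obtain n where n: "t \<le> real n" using real_arch_simple by blast
      have "(SUP n. ennreal (g t) * indicator {0..real n} t) = ennreal (g t)"
      proof (rule antisym)
        show "(SUP n. ennreal (g t) * indicator {0..real n} t) \<le> ennreal (g t)"
          by (rule SUP_least) (simp add: indicator_def)
        have "ennreal (g t) * indicator {0..real n} t \<le> (SUP n. ennreal (g t) * indicator {0..real n} t)"
          by (rule SUP_upper) simp
        thus "ennreal (g t) \<le> (SUP n. ennreal (g t) * indicator {0..real n} t)" using True n by simp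
      qed
      thus ?thesis using g_eq[OF True] True by simp
    qed simp
  qed
  also have "\<dots> = (SUP n. \<integral>\<^sup>+t\<in>{0..real n}. ennreal (g t) \<partial>lborel)"
  proof (rule nn_integral_monotone_convergence_SUP)
    show "incseq (\<lambda>n t. ennreal (g t) * indicator {0..real n} t)"
      by (auto simp: incseq_def le_fun_def indicator_def)
    fix n
    have "(\<lambda>t. ennreal (indicator {0..real n} t *\<^sub>R g t)) \<in> borel_measurable lborel"
      using borel_measurable_integrable[OF int[unfolded set_integrable_def], of "real n"]
      by (intro measurable_compose[OF _ measurable_ennreal]) simp
    moreover have "ennreal (indicator {0..real n} t *\<^sub>R g t) = ennreal (g t) * indicator {0..real n} t" for t
      by (simp add: indicator_def)
    ultimately show "(\<lambda>t. ennreal (g t) * indicator {0..real n} t) \<in> borel_measurable lborel" by simp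
  qed
  also have "\<dots> \<le> ennreal (lam k * (norm v)\<^sup>2)"
    by (intro SUP_least bound) simp
  finally show "(\<integral>\<^sup>+t\<in>{0..}. (\<integral>\<^sup>+\<omega>. ennreal (\<bar>x t \<omega> \<bullet> p k\<bar>\<^sup>2) \<partial>M) \<partial>lborel) \<le> ennreal (lam k * (norm v)\<^sup>2)" .
qed

end
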